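(* There is a permutation model of ZFA in which CS and CWF hold but $AC^{\omega}_{fin}$ fails, and moreover in which: (1) for every $3\le k<\omega$ and all graphs $G_1,G_2$ with $V_{G_1}$ linearly orderable, $\chi(E_{G_1})=k$ and $\chi(E_{G_2})\ge\omega$ imply $\chi(E_{G_1\times G_2})=k$; (2) for every infinite graph $G=(V_G,E_G)$ on a linearly ordered vertex set and every finite graph $H$, if every finite subgraph of $G$ has a homomorphism into $H$ then $G$ has a homomorphism into $H$; (3) for every finite field $\mathcal{F}=\langle F,\dots\rangle$ and every nontrivial linearly orderable vector space $V$ over $\mathcal{F}$ there is a non-zero linear functional $f:V\to F$.
   Context: CS: every partially ordered set without a maximal element has two disjoint cofinal subsets. CWF: every partially ordered set has a cofinal well-founded subset. $AC^{\omega}_{fin}$: every countably infinite family of non-empty finite sets has a choice function. A good coloring of $G$ is a map $f$ on $V_G$ with $f(x)\ne f(y)$ for $\{x,y\}\in E_G$; $\chi(E_G)$ is the least cardinal $\kappa$ such that $G$ has a good coloring with $\kappa$ colors; $\chi(E_G)\ge\omega$ means no finite good coloring exists. $G_1\times G_2$ has vertex set $V_{G_1}\times V_{G_2}$ and edges $\{(x_0,x_1),(y_0,y_1)\}$ with $\{x_0,y_0\}\in E_{G_1}$ and $\{x_1,y_1\}\in E_{G_2}$. A homomorphism $G\to H$ is a map $V_G\to V_H$ sending edges to edges. *)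

theory Defs
  imports "HOL-Algebra.Module" "HOL-Combinatorics.Permutations"
begin

section \<open>Structures for set theory with atoms\<close>

record 'v zfa_struct =
  Dom :: "'v set"
  Mem :: "'v \<Rightarrow> 'v \<Rightarrow> bool"
  Atoms :: "'v set"

text \<open>
  Every notion below takes the structure M in which it is read as an argument, and its
  quantifiers over objects of the theory range over \<open>Dom M\<close> (often via \<open>elts\<close> or \<open>isset\<close>).
  So for example \<open>finite_in M x\<close> says that M satisfies "x is finite".
\<close>

definition elts :: "'v zfa_struct \<Rightarrow> 'v \<Rightarrow> 'v set" where
  "elts M x = {y \<in> Dom M. Mem M y x}"

definition isset :: "'v zfa_struct \<Rightarrow> 'v \<Rightarrow> bool" where
  "isset M x \<longleftrightarrow> x \<in> Dom M \<and> x \<notin> Atoms M"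


subsection \<open>Ordered pairs, relations and functions inside a structure\<close>

definition is_upair :: "'v zfa_struct \<Rightarrow> 'v \<Rightarrow> 'v \<Rightarrow> 'v \<Rightarrow> bool" where
  "is_upair M a b p \<longleftrightarrow> isset M p \<and> a \<in> Dom M \<and> b \<in> Dom M \<and> elts M p = {a, b}"

definition is_pair :: "'v zfa_struct \<Rightarrow> 'v \<Rightarrow> 'v \<Rightarrow> 'v \<Rightarrow> bool" where
  "is_pair M a b p \<longleftrightarrow> (\<exists>u v. is_upair M a a u \<and> is_upair M a b v \<and> is_upair M u v p)"

definition is_rel :: "'v zfa_struct \<Rightarrow> 'v \<Rightarrow> bool" where
  "is_rel M r \<longleftrightarrow> isset M r \<and> (\<forall>p \<in> elts M r. \<exists>a b. is_pair M a b p)"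

definition rel :: "'v zfa_struct \<Rightarrow> 'v \<Rightarrow> ('v \<times> 'v) set" where
  "rel M r = {(a, b). \<exists>p \<in> elts M r. is_pair M a b p}"

definition is_cart :: "'v zfa_struct \<Rightarrow> 'v \<Rightarrow> 'v \<Rightarrow> 'v \<Rightarrow> bool" where
  "is_cart M X Y P \<longleftrightarrow> isset M P \<and> elts M P = {p. \<exists>x \<in> elts M X. \<exists>y \<in> elts M Y. is_pair M x y p}"

definition is_fun :: "'v zfa_struct \<Rightarrow> 'v \<Rightarrow> 'v \<Rightarrow> 'v \<Rightarrow> bool" where
  "is_fun M f X Y \<longleftrightarrow> isset M X \<and> isset M Y \<and> is_rel M f \<and> rel M f \<subseteq> elts M X \<times> elts M Y \<and>
     (\<forall>x \<in> elts M X. \<exists>!y. (x, y) \<in> rel M f)"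

definition app :: "'v zfa_struct \<Rightarrow> 'v \<Rightarrow> 'v \<Rightarrow> 'v" where
  "app M f x = (THE y. (x, y) \<in> rel M f)"

definition is_binop :: "'v zfa_struct \<Rightarrow> 'v \<Rightarrow> 'v \<Rightarrow> 'v \<Rightarrow> 'v \<Rightarrow> bool" where
  "is_binop M f X Y Z \<longleftrightarrow> isset M X \<and> isset M Y \<and> (\<exists>P. is_cart M X Y P \<and> is_fun M f P Z)"

definition app2 :: "'v zfa_struct \<Rightarrow> 'v \<Rightarrow> 'v \<Rightarrow> 'v \<Rightarrow> 'v" where
  "app2 M f x y = app M f (THE p. is_pair M x y p)"

definition is_bij :: "'v zfa_struct \<Rightarrow> 'v \<Rightarrow> 'v \<Rightarrow> 'v \<Rightarrow> bool" where
  "is_bij M f X Y \<longleftrightarrow> is_fun M f X Y \<and> bij_betw (app M f) (elts M X) (elts M Y)"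


subsection \<open>Natural numbers, finiteness and choice functions inside a structure\<close>

definition is_empty :: "'v zfa_struct \<Rightarrow> 'v \<Rightarrow> bool" where
  "is_empty M z \<longleftrightarrow> isset M z \<and> elts M z = {}"

definition is_succ :: "'v zfa_struct \<Rightarrow> 'v \<Rightarrow> 'v \<Rightarrow> bool" where
  "is_succ M x y \<longleftrightarrow> isset M y \<and> elts M y = insert x (elts M x)"

definition inductive_in :: "'v zfa_struct \<Rightarrow> 'v \<Rightarrow> bool" where
  "inductive_in M w \<longleftrightarrow> isset M w \<and> (\<exists>z \<in> elts M w. is_empty M z) \<and>
     (\<forall>x \<in> elts M w. \<exists>y \<in> elts M w. is_succ M x y)"

definition is_omega :: "'v zfa_struct \<Rightarrow> 'v \<Rightarrow> bool" where
  "is_omega M w \<longleftrightarrow> inductive_in M w \<and> (\<forall>u. inductive_in M u \<longrightarrow> elts M w \<subseteq> elts M u)"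

definition is_nat :: "'v zfa_struct \<Rightarrow> 'v \<Rightarrow> bool" where
  "is_nat M n \<longleftrightarrow> (\<exists>w. is_omega M w \<and> n \<in> elts M w)"

primrec is_numeral :: "'v zfa_struct \<Rightarrow> nat \<Rightarrow> 'v \<Rightarrow> bool" where
  "is_numeral M 0 x \<longleftrightarrow> is_empty M x"
| "is_numeral M (Suc n) x \<longleftrightarrow> (\<exists>y. is_numeral M n y \<and> is_succ M y x)"

definition finite_in :: "'v zfa_struct \<Rightarrow> 'v \<Rightarrow> bool" where
  "finite_in M x \<longleftrightarrow> isset M x \<and> (\<exists>n f. is_nat M n \<and> is_bij M f n x)"

definition countably_infinite_in :: "'v zfa_struct \<Rightarrow> 'v \<Rightarrow> bool" where
  "countably_infinite_in M x \<longleftrightarrow> isset M x \<and> (\<exists>w f. is_omega M w \<and> is_bij M f w x)"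

definition has_choice_function :: "'v zfa_struct \<Rightarrow> 'v \<Rightarrow> bool" where
  "has_choice_function M S \<longleftrightarrow> (\<exists>f U. is_fun M f S U \<and> (\<forall>a \<in> elts M S. app M f a \<in> elts M a))"

definition AC :: "'v zfa_struct \<Rightarrow> bool" where
  "AC M \<longleftrightarrow> (\<forall>S. isset M S \<and> (\<forall>a \<in> elts M S. isset M a \<and> elts M a \<noteq> {}) \<longrightarrow>
     has_choice_function M S)"


section \<open>The axioms of ZFA\<close>

text \<open>First-order formulas over membership, equality and the predicate "is an atom".\<close>

datatype fm =
    FMem nat nat
  | FEq nat nat
  | FAtom nat
  | FNeg fm
  | FConj fm fm
  | FAll nat fm

primrec sat :: "'v zfa_struct \<Rightarrow> fm \<Rightarrow> (nat \<Rightarrow> 'v) \<Rightarrow> bool" where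
  "sat M (FMem i j) e \<longleftrightarrow> Mem M (e i) (e j)"
| "sat M (FEq i j) e \<longleftrightarrow> e i = e j"
| "sat M (FAtom i) e \<longleftrightarrow> e i \<in> Atoms M"
| "sat M (FNeg p) e \<longleftrightarrow> \<not> sat M p e"
| "sat M (FConj p q) e \<longleftrightarrow> sat M p e \<and> sat M q e"
| "sat M (FAll i p) e \<longleftrightarrow> (\<forall>a \<in> Dom M. sat M p (e(i := a)))"

text \<open>
  The single axioms of ZFA, i.e. all except the two schemas: the atoms are memberless,
  extensionality for sets, the set of atoms, empty set, pairing, union, power set, infinity
  and foundation.
\<close>

definition ZFA_basic :: "'v zfa_struct \<Rightarrow> bool" where
  "ZFA_basic M \<longleftrightarrow>
     Atoms M \<subseteq> Dom M \<and>
     (\<forall>a \<in> Atoms M. elts M a = {}) \<and>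
     (\<forall>x y. isset M x \<and> isset M y \<and> elts M x = elts M y \<longrightarrow> x = y) \<and>
     (\<exists>A. isset M A \<and> elts M A = Atoms M) \<and>
     (\<exists>z. is_empty M z) \<and>
     (\<forall>a \<in> Dom M. \<forall>b \<in> Dom M. \<exists>p. is_upair M a b p) \<and>
     (\<forall>x. isset M x \<longrightarrow> (\<exists>u. isset M u \<and> elts M u = (\<Union>y \<in> elts M x. elts M y))) \<and>
     (\<forall>x. isset M x \<longrightarrow> (\<exists>p. isset M p \<and> elts M p = {y. isset M y \<and> elts M y \<subseteq> elts M x})) \<and>
     (\<exists>w. inductive_in M w) \<and>
     (\<forall>x. isset M x \<and> elts M x \<noteq> {} \<longrightarrow> (\<exists>y \<in> elts M x. elts M y \<inter> elts M x = {}))"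

text \<open>
  In both schemas the assignment e supplies the parameters; variable 0 (and 1 for the value
  in replacement) are the distinguished variables of the formula.
\<close>

definition separation_schema :: "'v zfa_struct \<Rightarrow> bool" where
  "separation_schema M \<longleftrightarrow>
     (\<forall>\<phi> e a. range e \<subseteq> Dom M \<and> isset M a \<longrightarrow>
        (\<exists>b. isset M b \<and> elts M b = {x \<in> elts M a. sat M \<phi> (e(0 := x))}))"

definition replacement_schema :: "'v zfa_struct \<Rightarrow> bool" where
  "replacement_schema M \<longleftrightarrow>
     (\<forall>\<phi> e a. range e \<subseteq> Dom M \<and> isset M a \<and>
        (\<forall>x \<in> elts M a. \<exists>!y. y \<in> Dom M \<and> sat M \<phi> (e(0 := x, 1 := y))) \<longrightarrow>
        (\<exists>b. isset M b \<and> elts M b = {y \<in> Dom M. \<exists>x \<in> elts M a. sat M \<phi> (e(0 := x, 1 := y))}))"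

definition ZFA :: "'v zfa_struct \<Rightarrow> bool" where
  "ZFA M \<longleftrightarrow> ZFA_basic M \<and> separation_schema M \<and> replacement_schema M"

text \<open>
  A universe of ZFA + AC: here separation and replacement hold for arbitrary HOL predicates and
  functions, which play the role of the classes of the metatheory. Atoms are allowed but not
  required; with no atoms this is a universe of ZFC.
\<close>

definition zfac_universe :: "'v zfa_struct \<Rightarrow> bool" where
  "zfac_universe M \<longleftrightarrow> ZFA_basic M \<and> AC M \<and>
     (\<forall>P a. isset M a \<longrightarrow> (\<exists>b. isset M b \<and> elts M b = {x \<in> elts M a. P x})) \<and>
     (\<forall>F a. isset M a \<and> F ` elts M a \<subseteq> Dom M \<longrightarrow> (\<exists>b. isset M b \<and> elts M b = F ` elts M a))"


section \<open>Permutation models\<close>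

text \<open>
  In a \<open>zfac_universe\<close>, every permutation of the atoms, every group of such permutations and
  every filter of subgroups is coded by an element of the universe, so HOL functions and sets
  can be used for them.
\<close>

definition perm_group :: "'v set \<Rightarrow> ('v \<Rightarrow> 'v) set \<Rightarrow> bool" where
  "perm_group A G \<longleftrightarrow> (\<forall>\<pi> \<in> G. \<pi> permutes A) \<and> id \<in> G \<and>
     (\<forall>\<pi> \<in> G. \<forall>\<rho> \<in> G. \<pi> \<circ> \<rho> \<in> G) \<and> (\<forall>\<pi> \<in> G. inv_into UNIV \<pi> \<in> G)"

definition normal_filter :: "'v set \<Rightarrow> ('v \<Rightarrow> 'v) set \<Rightarrow> ('v \<Rightarrow> 'v) set set \<Rightarrow> bool" where
  "normal_filter A G \<F> \<longleftrightarrow>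
     (\<forall>H \<in> \<F>. H \<subseteq> G \<and> perm_group A H) \<and>
     G \<in> \<F> \<and>
     (\<forall>H K. H \<in> \<F> \<and> H \<subseteq> K \<and> K \<subseteq> G \<and> perm_group A K \<longrightarrow> K \<in> \<F>) \<and>
     (\<forall>H \<in> \<F>. \<forall>K \<in> \<F>. H \<inter> K \<in> \<F>) \<and>
     (\<forall>\<pi> \<in> G. \<forall>H \<in> \<F>. (\<lambda>h. \<pi> \<circ> h \<circ> inv_into UNIV \<pi>) ` H \<in> \<F>) \<and>
     (\<forall>a \<in> A. {\<pi> \<in> G. \<pi> a = a} \<in> \<F>)"

definition mem_rel :: "'v zfa_struct \<Rightarrow> ('v \<times> 'v) set" where
  "mem_rel M = {(y, x). x \<in> Dom M \<and> y \<in> elts M x}"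

text \<open>
  The action of a permutation of the atoms on the universe: \<open>\<pi> x = {\<pi> y | y \<in> x}\<close> for sets x,
  by recursion on membership.
\<close>

definition act :: "'v zfa_struct \<Rightarrow> ('v \<Rightarrow> 'v) \<Rightarrow> 'v \<Rightarrow> 'v" where
  "act M \<pi> = wfrec (mem_rel M)
     (\<lambda>h x. if x \<in> Atoms M then \<pi> x else (THE z. isset M z \<and> elts M z = h ` elts M x))"

definition symmetric ::
    "'v zfa_struct \<Rightarrow> ('v \<Rightarrow> 'v) set \<Rightarrow> ('v \<Rightarrow> 'v) set set \<Rightarrow> 'v \<Rightarrow> bool" where
  "symmetric M G \<F> x \<longleftrightarrow> {\<pi> \<in> G. act M \<pi> x = x} \<in> \<F>"

text \<open>The pairs \<open>(y, x)\<close> below with fixed x run through the transitive closure of \<open>{x}\<close>.\<close>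

definition hereditarily_symmetric ::
    "'v zfa_struct \<Rightarrow> ('v \<Rightarrow> 'v) set \<Rightarrow> ('v \<Rightarrow> 'v) set set \<Rightarrow> 'v set" where
  "hereditarily_symmetric M G \<F> =
     {x \<in> Dom M. \<forall>y. (y, x) \<in> (mem_rel M)\<^sup>* \<longrightarrow> symmetric M G \<F> y}"

definition permutation_model :: "'v zfa_struct \<Rightarrow> bool" where
  "permutation_model N \<longleftrightarrow>
     (\<exists>M G \<F>. zfac_universe M \<and> perm_group (Atoms M) G \<and> normal_filter (Atoms M) G \<F> \<and>
        N = M\<lparr>Dom := hereditarily_symmetric M G \<F>\<rparr>)"


section \<open>Orders, and the principles CS, CWF and countable choice for finite sets\<close>

definition is_poset :: "'v zfa_struct \<Rightarrow> 'v \<Rightarrow> 'v \<Rightarrow> bool" where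
  "is_poset M P R \<longleftrightarrow> isset M P \<and> is_rel M R \<and> partial_order_on (elts M P) (rel M R)"

definition linearly_orderable :: "'v zfa_struct \<Rightarrow> 'v \<Rightarrow> bool" where
  "linearly_orderable M X \<longleftrightarrow> isset M X \<and>
     (\<exists>R. is_rel M R \<and> linear_order_on (elts M X) (rel M R))"

definition cofinal_in :: "'v zfa_struct \<Rightarrow> 'v \<Rightarrow> 'v \<Rightarrow> 'v \<Rightarrow> bool" where
  "cofinal_in M P R C \<longleftrightarrow> isset M C \<and> elts M C \<subseteq> elts M P \<and>
     (\<forall>p \<in> elts M P. \<exists>c \<in> elts M C. (p, c) \<in> rel M R)"

definition CS :: "'v zfa_struct \<Rightarrow> bool" where
  "CS M \<longleftrightarrow> (\<forall>P R. is_poset M P R \<and>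
     \<not> (\<exists>m \<in> elts M P. \<forall>p \<in> elts M P. (m, p) \<in> rel M R \<longrightarrow> p = m) \<longrightarrow>
     (\<exists>C D. cofinal_in M P R C \<and> cofinal_in M P R D \<and> elts M C \<inter> elts M D = {}))"

text \<open>Well-founded: every non-empty subset (in M) has a minimal element.\<close>

definition well_founded_in :: "'v zfa_struct \<Rightarrow> 'v \<Rightarrow> 'v \<Rightarrow> bool" where
  "well_founded_in M R W \<longleftrightarrow> (\<forall>X. isset M X \<and> elts M X \<subseteq> elts M W \<and> elts M X \<noteq> {} \<longrightarrow>
     (\<exists>m \<in> elts M X. \<forall>x \<in> elts M X. (x, m) \<in> rel M R \<longrightarrow> x = m))"

definition CWF :: "'v zfa_struct \<Rightarrow> bool" where
  "CWF M \<longleftrightarrow> (\<forall>P R. is_poset M P R \<longrightarrow> (\<exists>W. cofinal_in M P R W \<and> well_founded_in M R W))"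

definition AC_omega_fin :: "'v zfa_struct \<Rightarrow> bool" where
  "AC_omega_fin M \<longleftrightarrow> (\<forall>S. countably_infinite_in M S \<and>
     (\<forall>a \<in> elts M S. finite_in M a \<and> elts M a \<noteq> {}) \<longrightarrow> has_choice_function M S)"


section \<open>Graphs\<close>

definition is_graph :: "'v zfa_struct \<Rightarrow> 'v \<Rightarrow> 'v \<Rightarrow> bool" where
  "is_graph M V E \<longleftrightarrow> isset M V \<and> isset M E \<and>
     (\<forall>e \<in> elts M E. \<exists>x \<in> elts M V. \<exists>y \<in> elts M V. x \<noteq> y \<and> is_upair M x y e)"

definition adj :: "'v zfa_struct \<Rightarrow> 'v \<Rightarrow> 'v \<Rightarrow> 'v \<Rightarrow> bool" where
  "adj M E x y \<longleftrightarrow> (\<exists>e \<in> elts M E. is_upair M x y e)"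

definition good_coloring :: "'v zfa_struct \<Rightarrow> 'v \<Rightarrow> 'v \<Rightarrow> 'v \<Rightarrow> 'v \<Rightarrow> bool" where
  "good_coloring M V E k f \<longleftrightarrow> is_fun M f V k \<and> (\<forall>x y. adj M E x y \<longrightarrow> app M f x \<noteq> app M f y)"

text \<open>For a natural number k of M, the smaller cardinals are exactly the elements of k.\<close>

definition chromatic_eq :: "'v zfa_struct \<Rightarrow> 'v \<Rightarrow> 'v \<Rightarrow> 'v \<Rightarrow> bool" where
  "chromatic_eq M V E k \<longleftrightarrow> is_nat M k \<and> (\<exists>f. good_coloring M V E k f) \<and>
     (\<forall>m \<in> elts M k. \<nexists>f. good_coloring M V E m f)"

definition chromatic_infinite :: "'v zfa_struct \<Rightarrow> 'v \<Rightarrow> 'v \<Rightarrow> bool" where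
  "chromatic_infinite M V E \<longleftrightarrow> (\<forall>m. is_nat M m \<longrightarrow> (\<nexists>f. good_coloring M V E m f))"

definition is_product_graph ::
    "'v zfa_struct \<Rightarrow> 'v \<Rightarrow> 'v \<Rightarrow> 'v \<Rightarrow> 'v \<Rightarrow> 'v \<Rightarrow> 'v \<Rightarrow> bool" where
  "is_product_graph M V1 E1 V2 E2 V E \<longleftrightarrow> is_cart M V1 V2 V \<and> isset M E \<and>
     elts M E = {e. \<exists>x0 x1 y0 y1 p q. adj M E1 x0 y0 \<and> adj M E2 x1 y1 \<and>
                      is_pair M x0 x1 p \<and> is_pair M y0 y1 q \<and> is_upair M p q e}"

definition is_subgraph :: "'v zfa_struct \<Rightarrow> 'v \<Rightarrow> 'v \<Rightarrow> 'v \<Rightarrow> 'v \<Rightarrow> bool" where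
  "is_subgraph M V' E' V E \<longleftrightarrow> is_graph M V' E' \<and>
     elts M V' \<subseteq> elts M V \<and> elts M E' \<subseteq> elts M E"

definition has_hom :: "'v zfa_struct \<Rightarrow> 'v \<Rightarrow> 'v \<Rightarrow> 'v \<Rightarrow> 'v \<Rightarrow> bool" where
  "has_hom M VG EG VH EH \<longleftrightarrow>
     (\<exists>h. is_fun M h VG VH \<and> (\<forall>x y. adj M EG x y \<longrightarrow> adj M EH (app M h x) (app M h y)))"


section \<open>Fields and vector spaces\<close>

definition ring_of :: "'v zfa_struct \<Rightarrow> 'v \<Rightarrow> 'v \<Rightarrow> 'v \<Rightarrow> 'v \<Rightarrow> 'v \<Rightarrow> 'v ring" where
  "ring_of M F ad mu z u =
     \<lparr>carrier = elts M F, monoid.mult = app2 M mu, one = u, zero = z, add = app2 M ad\<rparr>"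

definition is_field :: "'v zfa_struct \<Rightarrow> 'v \<Rightarrow> 'v \<Rightarrow> 'v \<Rightarrow> 'v \<Rightarrow> 'v \<Rightarrow> bool" where
  "is_field M F ad mu z u \<longleftrightarrow> is_binop M ad F F F \<and> is_binop M mu F F F \<and>
     field (ring_of M F ad mu z u)"

text \<open>
  The record \<open>module\<close> of the library extends \<open>ring\<close>, but the locale \<open>module\<close> does not use the
  components \<open>mult\<close> and \<open>one\<close> of the module.
\<close>

definition module_of :: "'v zfa_struct \<Rightarrow> 'v \<Rightarrow> 'v \<Rightarrow> 'v \<Rightarrow> 'v \<Rightarrow> ('v, 'v) module" where
  "module_of M V ad z sc =
     \<lparr>carrier = elts M V, monoid.mult = undefined, one = undefined, zero = z, add = app2 M ad,
      smult = app2 M sc\<rparr>"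

definition is_vector_space ::
    "'v zfa_struct \<Rightarrow> 'v \<Rightarrow> 'v \<Rightarrow> 'v \<Rightarrow> 'v \<Rightarrow> 'v \<Rightarrow> 'v \<Rightarrow> 'v \<Rightarrow> 'v \<Rightarrow> 'v \<Rightarrow> bool" where
  "is_vector_space M F ad mu z u V vad vz sc \<longleftrightarrow>
     is_field M F ad mu z u \<and> is_binop M vad V V V \<and> is_binop M sc F V V \<and>
     module (ring_of M F ad mu z u) (module_of M V vad vz sc)"

definition is_linear_functional ::
    "'v zfa_struct \<Rightarrow> 'v \<Rightarrow> 'v \<Rightarrow> 'v \<Rightarrow> 'v \<Rightarrow> 'v \<Rightarrow> 'v \<Rightarrow> 'v \<Rightarrow> bool" where
  "is_linear_functional M F ad mu V vad sc f \<longleftrightarrow> is_fun M f V F \<and>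
     (\<forall>x \<in> elts M V. \<forall>y \<in> elts M V. app M f (app2 M vad x y) = app2 M ad (app M f x) (app M f y)) \<and>
     (\<forall>c \<in> elts M F. \<forall>x \<in> elts M V. app M f (app2 M sc c x) = app2 M mu c (app M f x))"

end

theory Submission
  imports Defs
begin

text \<open>
  The model is the second Fraenkel model, built over countably many pairs of atoms with the group of
  all permutations preserving each pair and with finite supports. Every group element is an
  involution, and this is all that is needed for the positive statements. An involution preserving
  a linear order is trivial, so a linearly orderable set is fixed pointwise by the stabilizer of a
  support, and functions on it obtained from choice in the ambient universe (colourings by
  compactness, functionals by Zorn's lemma) belong to the model. An involution preserving a partial
  order has no comparable orbit of size two, so the orbits under the stabilizer of a support are
  themselves partially ordered; unions of orbits lie in the model, and well-founded or disjoint
  cofinal families of orbits are supplied by choice outside. The family of pairs has no choice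
  function because a pair outside the support can be swapped.
\<close>

section \<open>Sets coded in a structure\<close>

text \<open>A \<open>zfac_universe\<close> need not contain any atoms, so a universe with a
  prescribed countable set of atoms is first built inside the given one. The group is the full power
  of Z/2 over the index set of the pairs. That it is abelian matters besides the involutions:
  conjugation is trivial, so the filter is normal at once, and a support of x supports every image
  of x as well. The obstacle in every positive statement is that an object found outside by choice
  must be closed under the swaps beyond one fixed support. Finiteness of the colour set or field
  supplies such a common support for all values of a map. The second factor of a graph product
  carries no order; it is coloured by data that do not change when a vertex is moved by such a swap.
  For partial orders no quotient by orbits is formed: the choice arguments are run on a preorder of
  points and must return sets closed under mutual comparability. The numerals of the model are the
  standard ones, so compactness outside speaks of the same finite sets as the model does.\<close>

definition small :: "'v zfa_struct \<Rightarrow> 'v set \<Rightarrow> bool" where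
  "small K X \<longleftrightarrow> (\<exists>x. isset K x \<and> elts K x = X)"

text \<open>Determined by extensionality, but only for coded sets; hence the \<open>small\<close>
  premises that accompany it everywhere.\<close>

definition mk :: "'v zfa_struct \<Rightarrow> 'v set \<Rightarrow> 'v" where
  "mk K X = (THE x. isset K x \<and> elts K x = X)"

definition pr :: "'v zfa_struct \<Rightarrow> 'v \<Rightarrow> 'v \<Rightarrow> 'v" where
  "pr K a b = mk K {mk K {a}, mk K {a, b}}"

primrec num :: "'v zfa_struct \<Rightarrow> nat \<Rightarrow> 'v" where
  "num K 0 = mk K {}"
| "num K (Suc n) = mk K (insert (num K n) (elts K (num K n)))"

lemma small_subset_Dom: "small K X \<Longrightarrow> X \<subseteq> Dom K"
  unfolding small_def elts_def by auto

lemma small_elts: "isset K x \<Longrightarrow> small K (elts K x)"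
  unfolding small_def by blast

lemma elts_Dom: "y \<in> elts K x \<Longrightarrow> y \<in> Dom K"
  unfolding elts_def by blast

lemma isset_Dom: "isset K x \<Longrightarrow> x \<in> Dom K"
  unfolding isset_def by blast

text \<open>Only the single axioms are assumed, so that the coding lemmas serve both the ambient
  universe and the permutation model, where separation and replacement for arbitrary HOL predicates
  and functions are not at hand.\<close>

locale zfa_basic =
  fixes K :: "'v zfa_struct"
  assumes basic: "ZFA_basic K"
begin

lemma
  shows extensionality: "\<forall>x y. isset K x \<and> isset K y \<and> elts K x = elts K y \<longrightarrow> x = y"
    and empty_set: "\<exists>z. is_empty K z"
    and pairing: "\<forall>a \<in> Dom K. \<forall>b \<in> Dom K. \<exists>p. is_upair K a b p"
    and union: "\<forall>x. isset K x \<longrightarrow> (\<exists>u. isset K u \<and> elts K u = (\<Union>y \<in> elts K x. elts K y))"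
    and power_set: "\<forall>x. isset K x \<longrightarrow>
      (\<exists>p. isset K p \<and> elts K p = {y. isset K y \<and> elts K y \<subseteq> elts K x})"
    and infinity: "\<exists>w. inductive_in K w"
    and foundation: "\<forall>x. isset K x \<and> elts K x \<noteq> {} \<longrightarrow>
      (\<exists>y \<in> elts K x. elts K y \<inter> elts K x = {})"
  by (insert basic[unfolded ZFA_basic_def]) (elim conjE, assumption)+

lemma elts_eqI: "isset K x \<Longrightarrow> isset K y \<Longrightarrow> elts K x = elts K y \<Longrightarrow> x = y"
  using extensionality by blast

lemma
  assumes "small K X"
  shows isset_mk: "isset K (mk K X)" and elts_mk: "elts K (mk K X) = X"
proof -
  obtain x where x: "isset K x" "elts K x = X"
    using assms unfolding small_def by blast
  have "mk K X = x"
    unfolding mk_def by (rule the_equality) (use x elts_eqI in auto)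
  with x show "isset K (mk K X)" "elts K (mk K X) = X" by auto
qed

lemma mk_Dom: "small K X \<Longrightarrow> mk K X \<in> Dom K"
  by (rule isset_Dom) (rule isset_mk)

lemma mk_eqI: "isset K x \<Longrightarrow> elts K x = X \<Longrightarrow> mk K X = x"
  unfolding mk_def by (rule the_equality) (auto intro: elts_eqI)

lemma isset_iff_mk: "small K X \<Longrightarrow> isset K x \<and> elts K x = X \<longleftrightarrow> x = mk K X"
  using mk_eqI isset_mk elts_mk by auto

lemma mk_inj:
  assumes "small K X" "small K Y"
  shows "mk K X = mk K Y \<longleftrightarrow> X = Y"
  by (metis assms elts_mk)

lemma small_empty: "small K {}"
  using empty_set unfolding small_def is_empty_def by blast

lemma small_doubleton: "a \<in> Dom K \<Longrightarrow> b \<in> Dom K \<Longrightarrow> small K {a, b}"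
  using pairing unfolding small_def is_upair_def by blast

lemma small_singleton: "a \<in> Dom K \<Longrightarrow> small K {a}"
  using small_doubleton[of a a] by simp

lemma small_Union: "isset K x \<Longrightarrow> small K (\<Union>y \<in> elts K x. elts K y)"
  using union unfolding small_def by blast

lemma small_Un: "small K X \<Longrightarrow> small K Y \<Longrightarrow> small K (X \<union> Y)"
  using small_Union[of "mk K {mk K X, mk K Y}"]
  by (simp add: elts_mk isset_mk mk_Dom small_doubleton)

lemma small_insert: "a \<in> Dom K \<Longrightarrow> small K X \<Longrightarrow> small K (insert a X)"
  using small_Un[of "{a}" X] small_singleton by simp

section \<open>Pairs, relations, functions and graphs inside a structure\<close>

lemma is_empty_iff: "is_empty K z \<longleftrightarrow> z = mk K {}"
  unfolding is_empty_def by (rule isset_iff_mk) (rule small_empty)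

lemma is_succ_iff: "isset K x \<Longrightarrow> is_succ K x y \<longleftrightarrow> y = mk K (insert x (elts K x))"
  unfolding is_succ_def by (intro isset_iff_mk small_insert small_elts isset_Dom)

lemma is_upair_iff: "is_upair K a b p \<longleftrightarrow> a \<in> Dom K \<and> b \<in> Dom K \<and> p = mk K {a, b}"
  unfolding is_upair_def using isset_iff_mk[OF small_doubleton] by auto

lemma is_pair_iff: "is_pair K a b p \<longleftrightarrow> a \<in> Dom K \<and> b \<in> Dom K \<and> p = pr K a b"
  unfolding is_pair_def is_upair_iff pr_def
  by (auto simp: mk_Dom small_doubleton small_singleton)

lemma small_pr:
  assumes "a \<in> Dom K" "b \<in> Dom K"
  shows "small K {mk K {a}, mk K {a, b}}"
  using assms by (simp add: small_doubleton small_singleton mk_Dom)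

lemma isset_pr: "a \<in> Dom K \<Longrightarrow> b \<in> Dom K \<Longrightarrow> isset K (pr K a b)"
  unfolding pr_def by (intro isset_mk small_pr)

lemma pr_Dom: "a \<in> Dom K \<Longrightarrow> b \<in> Dom K \<Longrightarrow> pr K a b \<in> Dom K"
  by (rule isset_Dom) (rule isset_pr)

lemma pr_inj:
  assumes "a \<in> Dom K" "b \<in> Dom K" "c \<in> Dom K" "d \<in> Dom K"
  shows "pr K a b = pr K c d \<longleftrightarrow> a = c \<and> b = d"
proof
  assume "pr K a b = pr K c d"
  then have "{mk K {a}, mk K {a, b}} = {mk K {c}, mk K {c, d}}"
    unfolding pr_def using mk_inj[OF small_pr small_pr] assms by simp
  then have "{{a}, {a, b}} = {{c}, {c, d}}"
    using assms mk_inj[OF small_doubleton small_doubleton]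
      mk_inj[OF small_singleton small_singleton] mk_inj[OF small_singleton small_doubleton]
      mk_inj[OF small_doubleton small_singleton]
    by (auto simp: doubleton_eq_iff)
  then show "a = c \<and> b = d" by (auto simp: doubleton_eq_iff)
qed simp

lemma rel_iff: "(a, b) \<in> rel K r \<longleftrightarrow> a \<in> Dom K \<and> b \<in> Dom K \<and> pr K a b \<in> elts K r"
  unfolding rel_def is_pair_iff by blast

text \<open>Smallness of the image is left as a premise because it is exactly the point where, in
  the permutation model, symmetry has to be proved.\<close>

lemma rel_exists:
  assumes "small K ((\<lambda>(a, b). pr K a b) ` Q)" "Q \<subseteq> Dom K \<times> Dom K"
  obtains r where "is_rel K r" "rel K r = Q"
proof
  let ?r = "mk K ((\<lambda>(a, b). pr K a b) ` Q)"
  show "is_rel K ?r"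
    unfolding is_rel_def using assms by (auto simp: isset_mk elts_mk is_pair_iff)
  show "rel K ?r = Q"
  proof (rule Set.set_eqI)
    fix z
    show "z \<in> rel K ?r \<longleftrightarrow> z \<in> Q"
    proof (cases z)
      case (Pair a b)
      show ?thesis
        unfolding Pair rel_iff elts_mk[OF assms(1)] using assms(2) pr_inj by (force simp: image_iff)
    qed
  qed
qed

lemma the_pair: "x \<in> Dom K \<Longrightarrow> y \<in> Dom K \<Longrightarrow> (THE p. is_pair K x y p) = pr K x y"
  by (simp add: is_pair_iff)

lemma fun_isset: "is_fun K f X Y \<Longrightarrow> isset K f"
  unfolding is_fun_def is_rel_def by blast

lemma
  assumes "is_fun K f X Y"
  shows fun_rel_subset: "rel K f \<subseteq> elts K X \<times> elts K Y"
    and fun_ex1: "x \<in> elts K X \<Longrightarrow> \<exists>!y. (x, y) \<in> rel K f"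
  using assms unfolding is_fun_def by simp_all

lemma app_rel: "is_fun K f X Y \<Longrightarrow> x \<in> elts K X \<Longrightarrow> (x, app K f x) \<in> rel K f"
  unfolding app_def by (rule theI') (rule fun_ex1)

lemma app_in: "is_fun K f X Y \<Longrightarrow> x \<in> elts K X \<Longrightarrow> app K f x \<in> elts K Y"
  using app_rel[of f X Y x] fun_rel_subset[of f X Y] by blast

lemma app_eqI:
  assumes "is_fun K f X Y" "(x, y) \<in> rel K f"
  shows "app K f x = y"
proof -
  have "x \<in> elts K X" using assms fun_rel_subset by blast
  then show ?thesis using fun_ex1[of f X Y x] app_rel[of f X Y x] assms by auto
qed

lemma fun_exists:
  assumes "isset K X" "isset K Y" and f: "\<And>x. x \<in> elts K X \<Longrightarrow> f x \<in> elts K Y"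
    and small: "small K ((\<lambda>x. pr K x (f x)) ` elts K X)"
  obtains \<phi> where "is_fun K \<phi> X Y" "\<And>x. x \<in> elts K X \<Longrightarrow> app K \<phi> x = f x"
proof -
  let ?Q = "(\<lambda>x. (x, f x)) ` elts K X"
  have "small K ((\<lambda>(a, b). pr K a b) ` ?Q)"
    using small by (simp add: image_image)
  moreover have "?Q \<subseteq> Dom K \<times> Dom K"
    by (auto intro: elts_Dom dest: f)
  ultimately obtain r where r: "is_rel K r" "rel K r = ?Q"
    using rel_exists by blast
  have r_fun: "is_fun K r X Y"
    unfolding is_fun_def using assms(1-3) r by auto
  show ?thesis
  proof (rule that[OF r_fun])
    fix x assume "x \<in> elts K X"
    then show "app K r x = f x" using app_eqI[OF r_fun] r by blast
  qed
qed

lemma cart_elts: "is_cart K X Y P \<Longrightarrow> elts K P = {pr K x y |x y. x \<in> elts K X \<and> y \<in> elts K Y}"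
  unfolding is_cart_def is_pair_iff by (auto intro: elts_Dom)

lemma app2_eq: "x \<in> Dom K \<Longrightarrow> y \<in> Dom K \<Longrightarrow> app2 K f x y = app K f (pr K x y)"
  unfolding app2_def by (simp add: the_pair)

lemma app2_in:
  assumes "is_binop K f X Y Z" "x \<in> elts K X" "y \<in> elts K Y"
  shows "app2 K f x y \<in> elts K Z"
proof -
  obtain P where "is_cart K X Y P" "is_fun K f P Z"
    using assms unfolding is_binop_def by blast
  with assms(2,3) have "app K f (pr K x y) \<in> elts K Z"
    by (intro app_in[where X = P and Y = Z]) (force simp: cart_elts)+
  then show ?thesis using assms(2,3) by (simp add: app2_eq elts_Dom)
qed

lemma adj_iff: "adj K E x y \<longleftrightarrow> x \<in> Dom K \<and> y \<in> Dom K \<and> mk K {x, y} \<in> elts K E"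
  unfolding adj_def is_upair_iff by blast

lemma adj_sym: "adj K E x y \<Longrightarrow> adj K E y x"
  unfolding adj_iff by (simp add: insert_commute)

lemma adj_in:
  assumes "is_graph K V E" "adj K E x y"
  shows "x \<in> elts K V" "y \<in> elts K V"
proof -
  from assms(2) have xy: "x \<in> Dom K" "y \<in> Dom K" "mk K {x, y} \<in> elts K E"
    unfolding adj_iff by auto
  with assms(1) obtain a b where ab: "a \<in> elts K V" "b \<in> elts K V" "mk K {x, y} = mk K {a, b}"
    unfolding is_graph_def is_upair_iff by blast
  then have "{x, y} = {a, b}"
    using xy by (simp add: mk_inj small_doubleton elts_Dom)
  with ab show "x \<in> elts K V" "y \<in> elts K V" by (auto simp: doubleton_eq_iff)
qed

lemma product_adj:
  assumes "is_product_graph K V1 E1 V2 E2 V E"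
  shows "adj K E p q \<longleftrightarrow> (\<exists>x0 x1 y0 y1. adj K E1 x0 y0 \<and> adj K E2 x1 y1 \<and>
    p = pr K x0 x1 \<and> q = pr K y0 y1)" (is "_ \<longleftrightarrow> ?rhs p q")
proof
  assume "adj K E p q"
  then obtain e where e: "e \<in> elts K E" "is_upair K p q e" unfolding adj_def by blast
  then obtain x0 x1 y0 y1 p' q' where *: "adj K E1 x0 y0" "adj K E2 x1 y1" "p' = pr K x0 x1"
    "q' = pr K y0 y1" "is_upair K p' q' e"
    using assms unfolding is_product_graph_def is_pair_iff by blast
  have "elts K e = {p, q}" "elts K e = {p', q'}"
    using e(2) *(5) unfolding is_upair_def by auto
  \<comment> \<open>An edge determines its end points only up to order; symmetry of both factors
    absorbs the exchange.\<close>
  then have "p = p' \<and> q = q' \<or> p = q' \<and> q = p'" by (auto simp: doubleton_eq_iff)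
  then show "?rhs p q" using * adj_sym by blast
next
  assume "?rhs p q"
  then obtain x0 x1 y0 y1 where *: "adj K E1 x0 y0" "adj K E2 x1 y1" "p = pr K x0 x1"
    "q = pr K y0 y1" by blast
  then have D: "x0 \<in> Dom K" "y0 \<in> Dom K" "x1 \<in> Dom K" "y1 \<in> Dom K" unfolding adj_iff by auto
  then have pq: "is_pair K x0 x1 p" "is_pair K y0 y1 q" "is_upair K p q (mk K {p, q})"
    using * by (auto simp: is_pair_iff is_upair_iff pr_Dom)
  then have "mk K {p, q} \<in> elts K E"
    using assms *(1,2) unfolding is_product_graph_def by blast
  then show "adj K E p q" using pq(3) unfolding adj_def by blast
qed


subsection \<open>Numerals\<close>

lemma isset_num: "isset K (num K n)"
  by (induction n) (auto intro!: isset_mk small_empty small_insert small_elts isset_Dom)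

lemma num_Dom: "num K n \<in> Dom K"
  by (rule isset_Dom) (rule isset_num)

lemma elts_num: "elts K (num K n) = num K ` {..<n}"
proof (induction n)
  case 0
  then show ?case by (simp add: elts_mk small_empty)
next
  case (Suc n)
  have "small K (insert (num K n) (elts K (num K n)))"
    by (intro small_insert num_Dom small_elts isset_num)
  then show ?case using Suc by (simp add: elts_mk lessThan_Suc)
qed

text \<open>The axiom of foundation is applied to the singleton of \<open>x\<close>.\<close>

lemma not_mem_self: "x \<notin> elts K x"
proof
  assume x: "x \<in> elts K x"
  then have s: "small K {x}" by (intro small_singleton elts_Dom)
  have "\<exists>y \<in> elts K (mk K {x}). elts K y \<inter> elts K (mk K {x}) = {}"
    using foundation isset_mk[OF s] elts_mk[OF s] by (metis insert_not_empty)
  with x show False unfolding elts_mk[OF s] by blast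
qed

lemma inj_num: "inj (num K)"
proof (rule linorder_injI)
  fix i j :: nat
  assume "i < j"
  then have "num K i \<in> elts K (num K j)" by (simp add: elts_num)
  then show "num K i \<noteq> num K j" using not_mem_self[of "num K j"] by auto
qed

lemma num_in_inductive: "inductive_in K u \<Longrightarrow> num K n \<in> elts K u"
proof (induction n)
  case 0
  then show ?case unfolding inductive_in_def is_empty_iff by auto
next
  case (Suc n)
  then show ?case
    unfolding inductive_in_def is_succ_iff[OF isset_num] by (force simp: is_succ_iff isset_num)
qed

lemma inductive_range_num:
  assumes "isset K w" "elts K w = range (num K)"
  shows "inductive_in K w"
  unfolding inductive_in_def is_empty_iff
proof (intro conjI ballI)
  show "\<exists>z \<in> elts K w. z = mk K {}" unfolding assms(2) using rangeI[of "num K" 0] by simp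
next
  fix x assume "x \<in> elts K w"
  then obtain n where n: "x = num K n" using assms by blast
  then have "is_succ K x (num K (Suc n))" by (simp add: is_succ_iff isset_num)
  then show "\<exists>y \<in> elts K w. is_succ K x y" using assms by blast
qed (fact assms)

end

text \<open>Once the standard numerals form a set of the structure, minimality forces its omega to
  consist of them, so internally finite sets are finite outside.\<close>

locale zfa_omega = zfa_basic +
  assumes small_range_num: "small K (range (num K))"
begin

lemma is_omega_iff: "is_omega K w \<longleftrightarrow> w = mk K (range (num K))"
proof
  let ?w = "mk K (range (num K))"
  have ind: "inductive_in K ?w"
    by (intro inductive_range_num isset_mk elts_mk small_range_num)
  show "w = ?w" if w: "is_omega K w"
  proof -
    have "elts K w \<subseteq> elts K ?w" "inductive_in K w"
      using w ind unfolding is_omega_def by auto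
    then have "elts K w = range (num K)"
      using num_in_inductive by (auto simp: elts_mk[OF small_range_num])
    moreover have "isset K w"
      using \<open>inductive_in K w\<close> unfolding inductive_in_def by blast
    ultimately show ?thesis using mk_eqI by simp
  qed
  show "is_omega K w" if "w = ?w"
    unfolding is_omega_def that using ind num_in_inductive
    by (auto simp: elts_mk[OF small_range_num])
qed

lemma is_nat_iff: "is_nat K n \<longleftrightarrow> n \<in> range (num K)"
  unfolding is_nat_def is_omega_iff by (simp add: elts_mk small_range_num)

lemma finite_in_imp_finite:
  assumes "finite_in K x"
  shows "finite (elts K x)"
proof -
  obtain n f where "is_bij K f (num K n) x"
    using assms unfolding finite_in_def is_nat_iff by blast
  then have "bij_betw (app K f) (num K ` {..<n}) (elts K x)"
    unfolding is_bij_def elts_num by blast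
  then show ?thesis using bij_betw_finite by blast
qed

end


section \<open>Cofinal subsets of preorders\<close>

text \<open>Fix a well-order of classes and keep a point if nothing above it has an earlier class.
  Among the points above \<open>p\<close>, one with the earliest class is kept, which gives
  cofinality. The well-order lives on \<open>'a set\<close> and is evaluated at equivalence classes
  so that equivalent points are kept or dropped together; for the preorder of orbits this makes
  \<open>W\<close> a union of orbits.\<close>

lemma preorder_wf_cofinal:
  fixes le :: "'a \<Rightarrow> 'a \<Rightarrow> bool"
  assumes refl: "\<And>x. x \<in> P \<Longrightarrow> le x x"
    and trans: "\<And>x y z. x \<in> P \<Longrightarrow> y \<in> P \<Longrightarrow> z \<in> P \<Longrightarrow> le x y \<Longrightarrow> le y z \<Longrightarrow> le x z"
  obtains W where "W \<subseteq> P" "\<And>x. x \<in> P \<Longrightarrow> \<exists>y \<in> W. le x y"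
    "\<And>x y. x \<in> W \<Longrightarrow> y \<in> P \<Longrightarrow> le x y \<Longrightarrow> le y x \<Longrightarrow> y \<in> W"
    "\<And>X. X \<subseteq> W \<Longrightarrow> X \<noteq> {} \<Longrightarrow> \<exists>m \<in> X. \<forall>x \<in> X. le x m \<longrightarrow> le m x"
proof -
  obtain r :: "'a set rel" where "well_order_on UNIV r"
    using well_order_on by blast
  define s where "s = r - Id"
  have wf: "wf s" and total: "\<And>A B. (A, B) \<in> s \<or> A = B \<or> (B, A) \<in> s"
    using \<open>well_order_on UNIV r\<close>
    unfolding s_def well_order_on_def linear_order_on_def total_on_def by auto
  have min_ex: "\<exists>z \<in> Q. \<forall>y. (y, z) \<in> s \<longrightarrow> y \<notin> Q" if "Q \<noteq> {}" for Q
    using wf that unfolding wf_eq_minimal by (metis ex_in_conv)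
  define cls where "cls x = {y \<in> P. le x y \<and> le y x}" for x
  define W where "W = {x \<in> P. \<forall>y \<in> P. le x y \<longrightarrow> (cls y, cls x) \<notin> s}"
  show ?thesis
  proof (rule that)
    show "W \<subseteq> P" unfolding W_def by blast
  next
    fix p assume p: "p \<in> P"
    let ?Q = "cls ` {y \<in> P. le p y}"
    have "cls p \<in> ?Q" using p refl by blast
    then have "?Q \<noteq> {}" by blast
    from min_ex[OF this] obtain y where y: "y \<in> P" "le p y"
      and min: "\<And>u. (u, cls y) \<in> s \<Longrightarrow> u \<notin> ?Q" by blast
    have "y \<in> W"
      unfolding W_def
    proof (intro CollectI conjI ballI impI)
      fix u assume "u \<in> P" "le y u"
      then have "cls u \<in> ?Q" using trans p y by blast
      then show "(cls u, cls y) \<notin> s" using min y by blast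
    qed (fact y)
    with y show "\<exists>y \<in> W. le p y" by blast
  next
    fix x y assume *: "x \<in> W" "y \<in> P" "le x y" "le y x"
    then have "x \<in> P" unfolding W_def by blast
    then have "cls x = cls y" unfolding cls_def using * trans by blast
    show "y \<in> W"
      unfolding W_def
    proof (intro CollectI conjI ballI impI)
      fix z assume z: "z \<in> P" "le y z"
      then have "le x z" using trans[of x y z] * \<open>x \<in> P\<close> by blast
      then show "(cls z, cls y) \<notin> s"
        using *(1) z(1) \<open>cls x = cls y\<close> unfolding W_def by auto
    qed (fact *(2))
  next
    fix X assume X: "X \<subseteq> W" "X \<noteq> {}"
    then have "cls ` X \<noteq> {}" by blast
    from min_ex[OF this] obtain m where m: "m \<in> X"
      and min: "\<And>y. (y, cls m) \<in> s \<Longrightarrow> y \<notin> cls ` X" by blast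
    show "\<exists>m \<in> X. \<forall>x \<in> X. le x m \<longrightarrow> le m x"
    proof (intro bexI[OF _ m(1)] ballI impI)
      fix x assume x: "x \<in> X" "le x m"
      \<comment> \<open>Since \<open>x\<close> was kept and \<open>m\<close> lies above it, the
        class of \<open>m\<close> is not earlier; since \<open>m\<close> has the earliest class in
        \<open>X\<close>, neither is that of \<open>x\<close>. So the classes coincide.\<close>
      have xm: "x \<in> W" "x \<in> P" "m \<in> P" using X x m unfolding W_def by auto
      then have "(cls m, cls x) \<notin> s" using x unfolding W_def by blast
      moreover have "(cls x, cls m) \<notin> s" using min m x by blast
      ultimately have "cls x = cls m" using total by blast
      moreover have "m \<in> cls m" unfolding cls_def using xm refl by blast
      ultimately show "le m x" unfolding cls_def by blast
    qed
  qed
qed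

text \<open>
  Zorn's lemma for pairs of disjoint, mutually cofinal sets, coded as subsets of
  \<open>P \<times> bool\<close>. If some q lies below no member of a maximal pair, then the even and the odd members
  of a strictly increasing sequence starting at q can be added to it.
\<close>

lemma preorder_disjoint_cofinal:
  fixes le :: "'a \<Rightarrow> 'a \<Rightarrow> bool"
  assumes refl: "\<And>x. x \<in> P \<Longrightarrow> le x x"
    and trans: "\<And>x y z. x \<in> P \<Longrightarrow> y \<in> P \<Longrightarrow> z \<in> P \<Longrightarrow> le x y \<Longrightarrow> le y z \<Longrightarrow> le x z"
    and no_max: "\<And>x. x \<in> P \<Longrightarrow> \<exists>y \<in> P. le x y \<and> \<not> le y x"
  obtains C :: "bool \<Rightarrow> 'a set" where "\<And>b. C b \<subseteq> P" "C True \<inter> C False = {}"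
    "\<And>b x. x \<in> P \<Longrightarrow> \<exists>y \<in> C b. le x y"
    "\<And>b x y. x \<in> C b \<Longrightarrow> y \<in> P \<Longrightarrow> le x y \<Longrightarrow> le y x \<Longrightarrow> y \<in> C b"
proof -
  \<comment> \<open>A pair \<open>(x, b)\<close> puts \<open>x\<close> into the set with label
    \<open>b\<close>. The third clause makes each set cofinal over the other, the fourth keeps
    equivalent points together, so that both sets become unions of orbits in the
    application.\<close>
  define good where "good Z \<longleftrightarrow> Z \<subseteq> P \<times> UNIV \<and> (\<forall>x. \<not> ((x, True) \<in> Z \<and> (x, False) \<in> Z)) \<and>
    (\<forall>x b c. (x, b) \<in> Z \<longrightarrow> (\<exists>y. (y, c) \<in> Z \<and> le x y)) \<and>
    (\<forall>x b y. (x, b) \<in> Z \<longrightarrow> y \<in> P \<longrightarrow> le x y \<longrightarrow> le y x \<longrightarrow> (y, b) \<in> Z)" for Z :: "('a \<times> bool) set"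
  have "\<Union>\<C> \<in> Collect good" if ch: "subset.chain (Collect good) \<C>" for \<C>
  proof -
    have gd: "\<And>Z. Z \<in> \<C> \<Longrightarrow> good Z" and cmp: "\<And>Z Y. Z \<in> \<C> \<Longrightarrow> Y \<in> \<C> \<Longrightarrow> Z \<subseteq> Y \<or> Y \<subseteq> Z"
      using ch unfolding subset_chain_def by blast+
    have "\<not> ((x, True) \<in> \<Union>\<C> \<and> (x, False) \<in> \<Union>\<C>)" for x
      using gd cmp unfolding good_def by (meson UnionE subsetD)
    moreover have "\<Union>\<C> \<subseteq> P \<times> UNIV" using gd unfolding good_def by blast
    moreover have "\<exists>y. (y, c) \<in> \<Union>\<C> \<and> le x y" if "(x, b) \<in> \<Union>\<C>" for x b c
      using gd that unfolding good_def by (meson UnionE UnionI)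
    moreover have "(y, b) \<in> \<Union>\<C>" if "(x, b) \<in> \<Union>\<C>" "y \<in> P" "le x y" "le y x" for x b y
      using gd that unfolding good_def by (meson UnionE UnionI)
    ultimately show ?thesis unfolding good_def by blast
  qed
  then obtain Z where Z: "good Z" and max: "\<And>Y. good Y \<Longrightarrow> Z \<subseteq> Y \<Longrightarrow> Y = Z"
    using subset_Zorn'[of "Collect good"] by auto
  have ZP: "x \<in> P" if "(x, b) \<in> Z" for x b using Z that unfolding good_def by blast
  have cof: "\<exists>x b. (x, b) \<in> Z \<and> le q x" if q: "q \<in> P" for q
  proof (rule ccontr)
    assume none: "\<not> ?thesis"
    obtain f where f: "\<And>x. x \<in> P \<Longrightarrow> f x \<in> P \<and> le x (f x) \<and> \<not> le (f x) x"
      using no_max by metis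
    define s where "s n = (f ^^ n) q" for n
    have sP: "s n \<in> P" for n by (induction n) (auto simp: s_def q f)
    have mono: "le (s i) (s j) \<and> (i < j \<longrightarrow> \<not> le (s j) (s i))" if "i \<le> j" for i j
      using that
    proof (induction j rule: dec_induct)
      case base
      then show ?case using refl sP by simp
    next
      case (step j)
      have "s (Suc j) = f (s j)" by (simp add: s_def)
      then show ?case using step f[OF sP[of j]] trans sP by metis
    qed
    define N where "N = {(x, b). x \<in> P \<and> (\<exists>n. le x (s n) \<and> le (s n) x \<and> even n = b)}"
    \<comment> \<open>Everything in \<open>N\<close> lies above \<open>q\<close>, so by
      \<open>none\<close> no point of \<open>N\<close> occurs in \<open>Z\<close>; this keeps the
      enlarged pair disjoint.\<close>
    have above: "le q x" if xb: "(x, b) \<in> N" for x b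
    proof -
      obtain n where n: "x \<in> P" "le (s n) x" using xb unfolding N_def by blast
      moreover have "le q (s n)" using mono[of 0 n] by (simp add: s_def)
      ultimately show ?thesis using trans[OF q sP] by blast
    qed
    have index: "n = m" if "x \<in> P" "le x (s n)" "le (s n) x" "le x (s m)" "le (s m) x" for x n m
      using that mono trans sP by (metis linorder_neqE_nat less_imp_le)
    have "good (Z \<union> N)"
      unfolding good_def
    proof (intro conjI allI impI)
      show "Z \<union> N \<subseteq> P \<times> UNIV" using ZP unfolding N_def by auto
    next
      fix x
      have "\<not> ((x, True) \<in> N \<and> (x, False) \<in> N)"
        using index unfolding N_def by blast
      then show "\<not> ((x, True) \<in> Z \<union> N \<and> (x, False) \<in> Z \<union> N)"
        using Z above none unfolding good_def by blast
    next
      fix x b c assume "(x, b) \<in> Z \<union> N"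
      then show "\<exists>y. (y, c) \<in> Z \<union> N \<and> le x y"
      proof
        assume "(x, b) \<in> Z"
        then show ?thesis using Z unfolding good_def by blast
      next
        assume "(x, b) \<in> N"
        then obtain n where n: "x \<in> P" "le x (s n)" unfolding N_def by blast
        obtain m where m: "n \<le> m" "even m = c"
          by (cases "even n = c") (use that[of n] that[of "Suc n"] in auto)
        then have "le x (s m)" "(s m, c) \<in> N"
          using n mono trans sP refl unfolding N_def by blast+
        then show ?thesis by blast
      qed
    next
      fix x b y assume *: "(x, b) \<in> Z \<union> N" "y \<in> P" "le x y" "le y x"
      have "(y, b) \<in> N" if "(x, b) \<in> N"
        using that * trans sP unfolding N_def by blast
      with * show "(y, b) \<in> Z \<union> N" using Z unfolding good_def by blast
    qed
    then have "N \<subseteq> Z" using max by blast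
    moreover have "(q, True) \<in> N"
      unfolding N_def using q refl by (auto simp: s_def intro!: exI[of _ 0])
    ultimately show False using none q refl by blast
  qed
  show ?thesis
  proof (rule that[of "\<lambda>b. {x. (x, b) \<in> Z}"])
    show "{x. (x, True) \<in> Z} \<inter> {x. (x, False) \<in> Z} = {}"
      using Z unfolding good_def by blast
    fix b
    show "{x. (x, b) \<in> Z} \<subseteq> P" using ZP by blast
    show "\<exists>y \<in> {x. (x, b) \<in> Z}. le x y" if "x \<in> P" for x
    proof -
      obtain z c where "(z, c) \<in> Z" "le x z" using cof \<open>x \<in> P\<close> by blast
      moreover then obtain y where "(y, b) \<in> Z" "le z y" using Z unfolding good_def by blast
      ultimately show ?thesis using trans ZP \<open>x \<in> P\<close> by blast
    qed
    show "y \<in> {x. (x, b) \<in> Z}" if "x \<in> {x. (x, b) \<in> Z}" "y \<in> P" "le x y" "le y x" for x y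
      using Z that unfolding good_def by blast
  qed
qed


section \<open>Compactness for finitely many colours\<close>

text \<open>Zorn's lemma is applied to sets \<open>p\<close> of assignments compatible with a
  homomorphism on every finite part of \<open>V\<close>; testing on a singleton shows that such a
  \<open>p\<close> is single-valued. The target relation \<open>Q\<close> is arbitrary, so the lemma
  covers graph homomorphisms and, with inequality, colourings.\<close>

lemma hom_compactness:
  assumes B: "finite B"
    and fin: "\<And>S. finite S \<Longrightarrow> S \<subseteq> V \<Longrightarrow>
      \<exists>h. h ` S \<subseteq> B \<and> (\<forall>x \<in> S. \<forall>y \<in> S. R x y \<longrightarrow> Q (h x) (h y))"
  obtains h where "h ` V \<subseteq> B" "\<And>x y. x \<in> V \<Longrightarrow> y \<in> V \<Longrightarrow> R x y \<Longrightarrow> Q (h x) (h y)"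
proof -
  define hom where "hom S h \<longleftrightarrow> h ` S \<subseteq> B \<and> (\<forall>x \<in> S. \<forall>y \<in> S. R x y \<longrightarrow> Q (h x) (h y))" for S h
  define good where "good p \<longleftrightarrow> p \<subseteq> V \<times> B \<and> (\<forall>S. finite S \<longrightarrow> S \<subseteq> V \<longrightarrow>
    (\<exists>h. hom S h \<and> (\<forall>x \<in> S. \<forall>b. (x, b) \<in> p \<longrightarrow> h x = b)))" for p
  have hom_mono: "hom S h" if "hom S' h" "S \<subseteq> S'" for S S' h
    using that unfolding hom_def by blast
  have good_empty: "good {}" unfolding good_def hom_def using fin by simp
  have "\<Union>\<C> \<in> Collect good" if ne: "\<C> \<noteq> {}" and ch: "subset.chain (Collect good) \<C>" for \<C>
  proof -
    have gd: "\<And>Z. Z \<in> \<C> \<Longrightarrow> good Z" using ch unfolding subset_chain_def by blast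
    have ext: "\<exists>h. hom S h \<and> (\<forall>x \<in> S. \<forall>b. (x, b) \<in> \<Union>\<C> \<longrightarrow> h x = b)"
      if S: "finite S" "S \<subseteq> V" for S
    proof -
      have sub: "\<Union>\<C> \<subseteq> V \<times> B" using gd unfolding good_def by blast
      \<comment> \<open>As \<open>S\<close> and \<open>B\<close> are finite, only finitely many
        assignments of the union concern \<open>S\<close>, and a single member of the chain already
        contains them.\<close>
      have "finite (\<Union>\<C> \<inter> S \<times> B)" using S B by blast
      then obtain p where p: "p \<in> \<C>" "\<Union>\<C> \<inter> S \<times> B \<subseteq> p"
        using finite_subset_Union_chain[OF _ _ ne ch] by blast
      then obtain h where "hom S h" "\<forall>x \<in> S. \<forall>b. (x, b) \<in> p \<longrightarrow> h x = b"
        using gd S unfolding good_def by blast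
      with p sub show ?thesis by blast
    qed
    have "\<Union>\<C> \<subseteq> V \<times> B" using gd unfolding good_def by blast
    then have "good (\<Union>\<C>)" unfolding good_def using ext by (intro conjI allI impI)
    then show ?thesis by simp
  qed
  then obtain p where p: "good p" and max: "\<And>q. good q \<Longrightarrow> p \<subseteq> q \<Longrightarrow> q = p"
    using subset_Zorn_nonempty[of "Collect good"] good_empty by auto
  have total: "\<exists>b. (x, b) \<in> p" if x: "x \<in> V" for x
  proof (rule ccontr)
    assume none: "\<not> ?thesis"
    have "\<exists>S. finite S \<and> S \<subseteq> V \<and>
        \<not> (\<exists>h. hom S h \<and> (\<forall>y \<in> S. \<forall>c. (y, c) \<in> insert (x, b) p \<longrightarrow> h y = c))"
      if b: "b \<in> B" for b
    proof (rule ccontr)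
      assume neg: "\<not> ?thesis"
      have "insert (x, b) p \<subseteq> V \<times> B" using p b x unfolding good_def by simp
      moreover have "\<forall>S. finite S \<longrightarrow> S \<subseteq> V \<longrightarrow>
          (\<exists>h. hom S h \<and> (\<forall>y \<in> S. \<forall>c. (y, c) \<in> insert (x, b) p \<longrightarrow> h y = c))"
        using neg by meson
      ultimately have "good (insert (x, b) p)" unfolding good_def by (rule conjI)
      then show False using max[of "insert (x, b) p"] none by auto
    qed
    \<comment> \<open>Each candidate value \<open>b\<close> for \<open>x\<close> is refuted by a
      finite set \<open>S b\<close>. The union of these sets with \<open>x\<close> is still finite,
      so it admits a compatible \<open>h\<close>, whose own value \<open>h x\<close> contradicts the
      refutation by \<open>S (h x)\<close>.\<close>
    then obtain S where S: "\<And>b. b \<in> B \<Longrightarrow> finite (S b) \<and> S b \<subseteq> V \<and>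
        \<not> (\<exists>h. hom (S b) h \<and> (\<forall>y \<in> S b. \<forall>c. (y, c) \<in> insert (x, b) p \<longrightarrow> h y = c))"
      by metis
    let ?S = "insert x (\<Union>b \<in> B. S b)"
    have "finite ?S" "?S \<subseteq> V" using S B x by auto
    then obtain h where h: "hom ?S h" "\<forall>y \<in> ?S. \<forall>c. (y, c) \<in> p \<longrightarrow> h y = c"
      using p unfolding good_def by blast
    then have hx: "h x \<in> B" unfolding hom_def by blast
    then have "hom (S (h x)) h" using hom_mono[OF h(1)] by blast
    moreover have "\<forall>y \<in> S (h x). \<forall>c. (y, c) \<in> insert (x, h x) p \<longrightarrow> h y = c"
      using h hx by blast
    ultimately show False using S hx by blast
  qed
  then obtain h where h: "\<And>x. x \<in> V \<Longrightarrow> (x, h x) \<in> p" by metis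
  show ?thesis
  proof (rule that)
    show "h ` V \<subseteq> B" using h p unfolding good_def by blast
  next
    fix x y assume xy: "x \<in> V" "y \<in> V" "R x y"
    then have "finite {x, y}" "{x, y} \<subseteq> V" by auto
    then obtain g where g: "hom {x, y} g" "\<forall>z \<in> {x, y}. \<forall>b. (z, b) \<in> p \<longrightarrow> g z = b"
      using p unfolding good_def by blast
    then have "g x = h x" "g y = h y" using h xy by auto
    with g xy show "Q (h x) (h y)" unfolding hom_def by auto
  qed
qed


section \<open>Linear functionals\<close>

context module
begin

text \<open>In this locale \<open>R\<close> is only a commutative ring, so these are the submodules;
  the name anticipates the application to a field.\<close>

definition subspace :: "'c set \<Rightarrow> bool" where
  "subspace W \<longleftrightarrow> W \<subseteq> carrier M \<and> \<zero>\<^bsub>M\<^esub> \<in> W \<and> (\<forall>x \<in> W. \<forall>y \<in> W. x \<oplus>\<^bsub>M\<^esub> y \<in> W) \<and>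
     (\<forall>c \<in> carrier R. \<forall>x \<in> W. c \<odot>\<^bsub>M\<^esub> x \<in> W)"

lemma subspace_minus:
  assumes "subspace W" "x \<in> W" "y \<in> W"
  shows "x \<ominus>\<^bsub>M\<^esub> y \<in> W"
proof -
  have "(\<ominus> \<one>) \<odot>\<^bsub>M\<^esub> y = \<ominus>\<^bsub>M\<^esub> y"
    using assms smult_l_minus[of \<one> y] smult_one[of y] unfolding subspace_def by auto
  then have "\<ominus>\<^bsub>M\<^esub> y \<in> W"
    using assms unfolding subspace_def by (metis R.a_inv_closed R.one_closed)
  then show ?thesis
    using assms unfolding subspace_def a_minus_def by blast
qed

lemma subspace_extend:
  assumes W: "subspace W" and x: "x \<in> carrier M"
  defines "W' \<equiv> {w \<oplus>\<^bsub>M\<^esub> c \<odot>\<^bsub>M\<^esub> x |w c. w \<in> W \<and> c \<in> carrier R}"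
  shows "subspace W'" "W \<subseteq> W'" "x \<in> W'"
proof -
  have WM: "\<And>w. w \<in> W \<Longrightarrow> w \<in> carrier M" and W0: "\<zero>\<^bsub>M\<^esub> \<in> W"
    and Wadd: "\<And>v w. v \<in> W \<Longrightarrow> w \<in> W \<Longrightarrow> v \<oplus>\<^bsub>M\<^esub> w \<in> W"
    and Wsm: "\<And>c w. c \<in> carrier R \<Longrightarrow> w \<in> W \<Longrightarrow> c \<odot>\<^bsub>M\<^esub> w \<in> W"
    using W unfolding subspace_def by blast+
  show WW': "W \<subseteq> W'"
  proof
    fix w assume w: "w \<in> W"
    then have "w = w \<oplus>\<^bsub>M\<^esub> \<zero> \<odot>\<^bsub>M\<^esub> x" using WM x smult_l_null by simp
    with w show "w \<in> W'" unfolding W'_def by blast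
  qed
  have "x = \<zero>\<^bsub>M\<^esub> \<oplus>\<^bsub>M\<^esub> \<one> \<odot>\<^bsub>M\<^esub> x" using x by simp
  with W0 show "x \<in> W'" unfolding W'_def by blast
  show "subspace W'"
    unfolding subspace_def
  proof (intro conjI ballI)
    show "W' \<subseteq> carrier M" unfolding W'_def using WM x by auto
    show "\<zero>\<^bsub>M\<^esub> \<in> W'" using WW' W0 by blast
  next
    fix y z assume "y \<in> W'" "z \<in> W'"
    then obtain v c w d where y: "y = v \<oplus>\<^bsub>M\<^esub> c \<odot>\<^bsub>M\<^esub> x" "v \<in> W" "c \<in> carrier R"
      and z: "z = w \<oplus>\<^bsub>M\<^esub> d \<odot>\<^bsub>M\<^esub> x" "w \<in> W" "d \<in> carrier R"
      unfolding W'_def by blast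
    then have "y \<oplus>\<^bsub>M\<^esub> z = (v \<oplus>\<^bsub>M\<^esub> w) \<oplus>\<^bsub>M\<^esub> (c \<oplus> d) \<odot>\<^bsub>M\<^esub> x"
      using WM x by (simp add: smult_l_distr M.a_ac)
    then show "y \<oplus>\<^bsub>M\<^esub> z \<in> W'" unfolding W'_def using y z Wadd R.a_closed by blast
  next
    fix c y assume c: "c \<in> carrier R" and "y \<in> W'"
    then obtain w d where y: "y = w \<oplus>\<^bsub>M\<^esub> d \<odot>\<^bsub>M\<^esub> x" "w \<in> W" "d \<in> carrier R"
      unfolding W'_def by blast
    then have "c \<odot>\<^bsub>M\<^esub> y = c \<odot>\<^bsub>M\<^esub> w \<oplus>\<^bsub>M\<^esub> (c \<otimes> d) \<odot>\<^bsub>M\<^esub> x"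
      using c WM x by (simp add: smult_r_distr smult_assoc1)
    then show "c \<odot>\<^bsub>M\<^esub> y \<in> W'" unfolding W'_def using c y Wsm R.m_closed by blast
  qed
qed

text \<open>The functional is the coordinate along v modulo a maximal subspace avoiding v.\<close>

lemma nonzero_functional:
  assumes "field R" and v: "v \<in> carrier M" "v \<noteq> \<zero>\<^bsub>M\<^esub>"
  obtains f where "\<And>x. x \<in> carrier M \<Longrightarrow> f x \<in> carrier R"
    "\<And>x y. x \<in> carrier M \<Longrightarrow> y \<in> carrier M \<Longrightarrow> f (x \<oplus>\<^bsub>M\<^esub> y) = f x \<oplus> f y"
    "\<And>c x. c \<in> carrier R \<Longrightarrow> x \<in> carrier M \<Longrightarrow> f (c \<odot>\<^bsub>M\<^esub> x) = c \<otimes> f x"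
    "f v = \<one>"
proof -
  interpret R: field R by fact
  define \<A> where "\<A> = {W. subspace W \<and> v \<notin> W}"
  have "{\<zero>\<^bsub>M\<^esub>} \<in> \<A>" unfolding \<A>_def subspace_def using v by auto
  moreover have "\<Union>\<C> \<in> \<A>" if ne: "\<C> \<noteq> {}" and ch: "subset.chain \<A> \<C>" for \<C>
  proof -
    have sub: "\<And>W. W \<in> \<C> \<Longrightarrow> subspace W \<and> v \<notin> W"
      and cmp: "\<And>W W'. W \<in> \<C> \<Longrightarrow> W' \<in> \<C> \<Longrightarrow> W \<subseteq> W' \<or> W' \<subseteq> W"
      using ch unfolding subset_chain_def \<A>_def by blast+
    have "x \<oplus>\<^bsub>M\<^esub> y \<in> \<Union>\<C>" if xy: "x \<in> \<Union>\<C>" "y \<in> \<Union>\<C>" for x y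
    proof -
      obtain W where "W \<in> \<C>" "x \<in> W" "y \<in> W" using xy cmp by blast
      then show ?thesis using sub unfolding subspace_def by blast
    qed
    moreover have "\<Union>\<C> \<subseteq> carrier M" "\<zero>\<^bsub>M\<^esub> \<in> \<Union>\<C>" "v \<notin> \<Union>\<C>"
      "\<forall>c \<in> carrier R. \<forall>x \<in> \<Union>\<C>. c \<odot>\<^bsub>M\<^esub> x \<in> \<Union>\<C>"
      using sub ne unfolding subspace_def by blast+
    ultimately show ?thesis unfolding \<A>_def subspace_def by blast
  qed
  ultimately obtain W where "W \<in> \<A>" and max: "\<And>X. X \<in> \<A> \<Longrightarrow> W \<subseteq> X \<Longrightarrow> X = W"
    using subset_Zorn_nonempty[of \<A>] by blast
  then have W: "subspace W" and vW: "v \<notin> W" unfolding \<A>_def by auto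
  have WM: "\<And>w. w \<in> W \<Longrightarrow> w \<in> carrier M" and W0: "\<zero>\<^bsub>M\<^esub> \<in> W"
    and Wadd: "\<And>v w. v \<in> W \<Longrightarrow> w \<in> W \<Longrightarrow> v \<oplus>\<^bsub>M\<^esub> w \<in> W"
    and Wsm: "\<And>c w. c \<in> carrier R \<Longrightarrow> w \<in> W \<Longrightarrow> c \<odot>\<^bsub>M\<^esub> w \<in> W"
    using W unfolding subspace_def by blast+
  have ex: "\<exists>c. c \<in> carrier R \<and> x \<ominus>\<^bsub>M\<^esub> c \<odot>\<^bsub>M\<^esub> v \<in> W" if x: "x \<in> carrier M" for x
  proof (cases "x \<in> W")
    case True
    then have "x \<ominus>\<^bsub>M\<^esub> \<zero> \<odot>\<^bsub>M\<^esub> v \<in> W" using subspace_minus[OF W True W0] v smult_l_null by simp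
    then show ?thesis by blast
  next
    case False
    \<comment> \<open>The subspace spanned by \<open>W\<close> and \<open>x\<close> is properly
      larger than \<open>W\<close>, so by maximality it cannot avoid \<open>v\<close>. The
      coefficient of \<open>x\<close> in the resulting equation is nonzero, since otherwise
      \<open>v\<close> would lie in \<open>W\<close>, and can be divided out.\<close>
    then have "v \<in> {w \<oplus>\<^bsub>M\<^esub> c \<odot>\<^bsub>M\<^esub> x |w c. w \<in> W \<and> c \<in> carrier R}"
      using subspace_extend[OF W x] max unfolding \<A>_def by blast
    then obtain w c where vw: "v = w \<oplus>\<^bsub>M\<^esub> c \<odot>\<^bsub>M\<^esub> x" and w: "w \<in> W" and c: "c \<in> carrier R"
      by blast
    have "c \<noteq> \<zero>" using vw w vW WM x smult_l_null by auto
    then have ic: "inv c \<in> carrier R" "inv c \<otimes> c = \<one>"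
      using c R.field_Units by auto
    have "inv c \<odot>\<^bsub>M\<^esub> v = inv c \<odot>\<^bsub>M\<^esub> w \<oplus>\<^bsub>M\<^esub> x"
      unfolding vw using ic c w WM x by (simp add: smult_r_distr flip: smult_assoc1)
    then have "x \<ominus>\<^bsub>M\<^esub> inv c \<odot>\<^bsub>M\<^esub> v = \<zero>\<^bsub>M\<^esub> \<ominus>\<^bsub>M\<^esub> inv c \<odot>\<^bsub>M\<^esub> w"
      using ic w WM x by (simp add: a_minus_def M.minus_add M.a_ac M.r_neg1 M.r_neg2)
    moreover have "\<zero>\<^bsub>M\<^esub> \<ominus>\<^bsub>M\<^esub> inv c \<odot>\<^bsub>M\<^esub> w \<in> W"
      using subspace_minus[OF W] W0 Wsm ic w by blast
    ultimately show ?thesis using ic by auto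
  qed
  \<comment> \<open>Two different coordinates of \<open>x\<close> would put a nonzero multiple of
    \<open>v\<close>, hence \<open>v\<close>, into \<open>W\<close>. Linearity of \<open>f\<close>
    is read off from this uniqueness.\<close>
  have uniq: "c = d" if "c \<in> carrier R" "d \<in> carrier R" "x \<in> carrier M"
    "x \<ominus>\<^bsub>M\<^esub> c \<odot>\<^bsub>M\<^esub> v \<in> W" "x \<ominus>\<^bsub>M\<^esub> d \<odot>\<^bsub>M\<^esub> v \<in> W" for c d x
  proof (rule ccontr)
    assume "c \<noteq> d"
    let ?e = "d \<ominus> c"
    have "d = ?e \<oplus> c" using that by (simp add: a_minus_def R.a_assoc R.l_neg)
    then have e: "?e \<in> carrier R" "?e \<noteq> \<zero>" using that \<open>c \<noteq> d\<close> by auto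
    have "(x \<ominus>\<^bsub>M\<^esub> c \<odot>\<^bsub>M\<^esub> v) \<ominus>\<^bsub>M\<^esub> (x \<ominus>\<^bsub>M\<^esub> d \<odot>\<^bsub>M\<^esub> v) = ?e \<odot>\<^bsub>M\<^esub> v"
      using that v
      by (simp add: a_minus_def smult_l_distr smult_l_minus M.minus_add M.a_ac M.r_neg1 M.r_neg2)
    then have "?e \<odot>\<^bsub>M\<^esub> v \<in> W" using subspace_minus[OF W] that by metis
    then have "inv ?e \<odot>\<^bsub>M\<^esub> (?e \<odot>\<^bsub>M\<^esub> v) \<in> W" using Wsm e R.field_Units by auto
    then show False using vW v e R.field_Units by (simp flip: smult_assoc1)
  qed
  obtain f where f: "\<And>x. x \<in> carrier M \<Longrightarrow> f x \<in> carrier R \<and> x \<ominus>\<^bsub>M\<^esub> f x \<odot>\<^bsub>M\<^esub> v \<in> W"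
    using ex by metis
  show ?thesis
  proof (rule that)
    show "f x \<in> carrier R" if "x \<in> carrier M" for x using f that by blast
  next
    fix x y assume xy: "x \<in> carrier M" "y \<in> carrier M"
    then have fxy: "f x \<in> carrier R" "f y \<in> carrier R" using f by auto
    have "(x \<ominus>\<^bsub>M\<^esub> f x \<odot>\<^bsub>M\<^esub> v) \<oplus>\<^bsub>M\<^esub> (y \<ominus>\<^bsub>M\<^esub> f y \<odot>\<^bsub>M\<^esub> v) = (x \<oplus>\<^bsub>M\<^esub> y) \<ominus>\<^bsub>M\<^esub> (f x \<oplus> f y) \<odot>\<^bsub>M\<^esub> v"
      using xy fxy v by (simp add: a_minus_def smult_l_distr M.minus_add M.a_ac)
    then have "(x \<oplus>\<^bsub>M\<^esub> y) \<ominus>\<^bsub>M\<^esub> (f x \<oplus> f y) \<odot>\<^bsub>M\<^esub> v \<in> W"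
      using Wadd f xy by metis
    then show "f (x \<oplus>\<^bsub>M\<^esub> y) = f x \<oplus> f y"
      using uniq[of _ _ "x \<oplus>\<^bsub>M\<^esub> y"] f xy fxy by auto
  next
    fix c x assume cx: "c \<in> carrier R" "x \<in> carrier M"
    then have fx: "f x \<in> carrier R" using f by auto
    have "c \<odot>\<^bsub>M\<^esub> (x \<ominus>\<^bsub>M\<^esub> f x \<odot>\<^bsub>M\<^esub> v) = c \<odot>\<^bsub>M\<^esub> x \<ominus>\<^bsub>M\<^esub> (c \<otimes> f x) \<odot>\<^bsub>M\<^esub> v"
      using cx fx v by (simp add: a_minus_def smult_r_distr smult_assoc1 smult_r_minus)
    then have "c \<odot>\<^bsub>M\<^esub> x \<ominus>\<^bsub>M\<^esub> (c \<otimes> f x) \<odot>\<^bsub>M\<^esub> v \<in> W"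
      using Wsm f cx by metis
    then show "f (c \<odot>\<^bsub>M\<^esub> x) = c \<otimes> f x"
      using uniq[of _ _ "c \<odot>\<^bsub>M\<^esub> x"] f cx fx by auto
  next
    have "v \<ominus>\<^bsub>M\<^esub> \<one> \<odot>\<^bsub>M\<^esub> v \<in> W" using v W0 by (simp add: a_minus_def M.r_neg)
    then show "f v = \<one>" using uniq[of _ _ v] f v by auto
  qed
qed

end


section \<open>Universes with arbitrary separation and replacement\<close>

text \<open>Choice is not among the assumptions: HOL's choice operator together with replacement for
  arbitrary functions yields it (\<open>zfac_universeI\<close>). The universe with new atoms
  therefore has only these clauses to satisfy.\<close>

locale zfa_univ = zfa_basic K for K :: "'v zfa_struct" +
  assumes separation: "isset K a \<Longrightarrow> \<exists>b. isset K b \<and> elts K b = {x \<in> elts K a. P x}"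
    and replacement: "isset K a \<Longrightarrow> F ` elts K a \<subseteq> Dom K \<Longrightarrow> \<exists>b. isset K b \<and> elts K b = F ` elts K a"
begin

lemma small_subset:
  assumes "small K X" "Y \<subseteq> X"
  shows "small K Y"
proof -
  have "Y = {x \<in> X. x \<in> Y}" using assms(2) by blast
  then show ?thesis
    using separation[of "mk K X" "\<lambda>x. x \<in> Y"] isset_mk[OF assms(1)] elts_mk[OF assms(1)]
    unfolding small_def by simp
qed

lemma small_image: "small K X \<Longrightarrow> f ` X \<subseteq> Dom K \<Longrightarrow> small K (f ` X)"
  using replacement[of "mk K X" f] unfolding small_def[of K "f ` X"]
  by (simp add: isset_mk elts_mk)

lemma small_UN:
  assumes "small K I" "\<And>i. i \<in> I \<Longrightarrow> small K (F i)"
  shows "small K (\<Union>i \<in> I. F i)"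
proof -
  let ?J = "(\<lambda>i. mk K (F i)) ` I"
  have J: "small K ?J"
    using assms mk_Dom by (intro small_image) auto
  have "(\<Union>i \<in> I. F i) = (\<Union>y \<in> ?J. elts K y)"
    using assms elts_mk by auto
  then show ?thesis
    using small_Union[OF isset_mk[OF J]] elts_mk[OF J] by simp
qed

lemma small_Pow:
  assumes "small K X"
  shows "small K {y. isset K y \<and> elts K y \<subseteq> X}"
  using power_set isset_mk[OF assms] elts_mk[OF assms] unfolding small_def by metis

text \<open>Any inductive set contains all numerals; unrestricted separation cuts them out, and
  replacement carries them along \<open>g\<close>.\<close>

lemma small_countable:
  fixes g :: "nat \<Rightarrow> 'v"
  assumes "range g \<subseteq> Dom K"
  shows "small K (range g)"
proof -
  obtain w where w: "inductive_in K w" using infinity by blast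
  then have "isset K w" unfolding inductive_in_def by blast
  moreover have "range (num K) \<subseteq> elts K w" using num_in_inductive[OF w] by blast
  ultimately have "small K (range (num K))" using small_subset[OF small_elts] by blast
  then have "small K ((\<lambda>x. g (inv_into UNIV (num K) x)) ` range (num K))"
    using assms by (intro small_image) auto
  then show ?thesis by (simp add: image_image inj_num)
qed

lemma zfac_universeI: "zfac_universe K"
proof -
  have "has_choice_function K S" if S: "isset K S" "\<forall>a \<in> elts K S. isset K a \<and> elts K a \<noteq> {}" for S
  proof -
    have U: "small K (\<Union>a \<in> elts K S. elts K a)" using small_Union S by blast
    define f where "f a = (SOME x. x \<in> elts K a)" for a
    have f: "f a \<in> elts K a" if "a \<in> elts K S" for a
      unfolding f_def using S that by (simp add: some_in_eq)
    have "small K ((\<lambda>x. pr K x (f x)) ` elts K S)"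
      by (intro small_image small_elts S(1)) (auto intro!: pr_Dom intro: elts_Dom f)
    then obtain \<phi> where "is_fun K \<phi> S (mk K (\<Union>a \<in> elts K S. elts K a))"
      "\<And>x. x \<in> elts K S \<Longrightarrow> app K \<phi> x = f x"
      using fun_exists[OF S(1) isset_mk[OF U], of f] f by (auto simp: elts_mk[OF U])
    with f show ?thesis unfolding has_choice_function_def by metis
  qed
  then have "AC K" unfolding AC_def by blast
  then show ?thesis
    unfolding zfac_universe_def
    by (intro conjI allI impI separation replacement basic) simp_all
qed

end

lemma zfa_univI: "zfac_universe K \<Longrightarrow> zfa_univ K"
  unfolding zfac_universe_def zfa_univ_def zfa_univ_axioms_def zfa_basic_def by simp


subsection \<open>Adding atoms to a universe\<close>

text \<open>
  The empty set serves as a mark that is an element of every code of a set and of no code of an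
  atom, and is no code itself.
\<close>

definition code :: "'v zfa_struct \<Rightarrow> 'v set \<Rightarrow> 'v" where
  "code K X = mk K (insert (mk K {}) X)"

definition atom :: "'v zfa_struct \<Rightarrow> nat \<Rightarrow> 'v" where
  "atom K n = mk K {mk K {num K n}}"

inductive_set cumul :: "'v zfa_struct \<Rightarrow> 'v set" for K where
  atom: "atom K n \<in> cumul K"
| code: "small K X \<Longrightarrow> (\<And>x. x \<in> X \<Longrightarrow> x \<in> cumul K) \<Longrightarrow> code K X \<in> cumul K"

text \<open>The elements that the chosen atoms have in \<open>K\<close> are hidden by changing
  \<open>Mem\<close>, whereas the mark inside a code disappears by itself, because it lies outside
  \<open>cumul K\<close>. Atoms that \<open>K\<close> itself may have are not in
  \<open>cumul K\<close> either.\<close>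

definition with_atoms :: "'v zfa_struct \<Rightarrow> 'v zfa_struct" where
  "with_atoms K = \<lparr>Dom = cumul K, Mem = \<lambda>y z. z \<notin> range (atom K) \<and> Mem K y z,
     Atoms = range (atom K)\<rparr>"

section \<open>The hierarchy over the new atoms is again a universe\<close>

context zfa_univ
begin

lemma small_mark: "small K X \<Longrightarrow> small K (insert (mk K {}) X)"
  by (intro small_insert mk_Dom small_empty)

lemma elts_code: "small K X \<Longrightarrow> elts K (code K X) = insert (mk K {}) X"
  unfolding code_def by (intro elts_mk small_mark)

lemma elts_atom: "elts K (atom K n) = {mk K {num K n}}"
  unfolding atom_def by (intro elts_mk small_singleton mk_Dom num_Dom)

lemma mark_neq: "mk K {num K n} \<noteq> mk K {}"
  using mk_inj[OF small_singleton[OF num_Dom] small_empty] by simp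

lemma inj_atom: "inj (atom K)"
proof (rule injI)
  fix m n assume "atom K m = atom K n"
  then have "mk K {num K m} = mk K {num K n}" using elts_atom by (metis the_elem_eq)
  then have "num K m = num K n"
    using mk_inj[OF small_singleton[OF num_Dom] small_singleton[OF num_Dom]] by simp
  then show "m = n" using inj_num by (simp add: inj_eq)
qed

lemma code_neq_atom: "small K X \<Longrightarrow> code K X \<noteq> atom K n"
  using elts_code[of X] elts_atom[of n] mark_neq[of n] by auto

lemma cumul_Dom: "x \<in> cumul K \<Longrightarrow> x \<in> Dom K"
  by (induction rule: cumul.induct)
    (auto simp: atom_def code_def intro!: mk_Dom small_singleton num_Dom small_mark)

lemma mark_notin_cumul: "mk K {} \<notin> cumul K"
proof
  assume "mk K {} \<in> cumul K"
  then show False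
  proof cases
    case (atom n)
    then show ?thesis using elts_atom[of n] elts_mk[OF small_empty] by simp
  next
    case (code X)
    then show ?thesis using elts_code[of X] elts_mk[OF small_empty] by simp
  qed
qed

abbreviation M where "M \<equiv> with_atoms K"

lemma M_simps: "Dom M = cumul K" "Atoms M = range (atom K)"
  unfolding with_atoms_def by simp_all

lemma elts_M_atom: "elts M (atom K n) = {}"
  unfolding elts_def with_atoms_def by simp

lemma elts_M_code:
  assumes "small K X" "X \<subseteq> cumul K"
  shows "elts M (code K X) = X"
proof -
  have "elts M (code K X) = cumul K \<inter> elts K (code K X)"
    unfolding elts_def with_atoms_def using code_neq_atom[OF assms(1)] cumul_Dom by auto
  then show ?thesis using elts_code[OF assms(1)] assms(2) mark_notin_cumul by auto
qed

lemma isset_M: "isset M z \<longleftrightarrow> (\<exists>X. small K X \<and> X \<subseteq> cumul K \<and> z = code K X)"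
proof
  assume "isset M z"
  then have "z \<in> cumul K" "z \<notin> range (atom K)" unfolding isset_def M_simps by auto
  then show "\<exists>X. small K X \<and> X \<subseteq> cumul K \<and> z = code K X"
    by cases auto
next
  assume "\<exists>X. small K X \<and> X \<subseteq> cumul K \<and> z = code K X"
  then show "isset M z"
    unfolding isset_def M_simps using code_neq_atom cumul.code by fast
qed

lemma small_M: "small M X \<longleftrightarrow> small K X \<and> X \<subseteq> cumul K"
  unfolding small_def[of M] isset_M using elts_M_code by auto

lemma small_elts_M: "x \<in> cumul K \<Longrightarrow> small K (elts M x)"
  by (erule cumul.cases) (auto simp: elts_M_atom small_empty elts_M_code subset_iff)

lemma small_M_ex: "small K X \<Longrightarrow> X \<subseteq> cumul K \<Longrightarrow> \<exists>z. isset M z \<and> elts M z = X"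
  using small_M unfolding small_def[of M] by blast

text \<open>Induction over \<open>cumul\<close> gives well-foundedness in the sense of HOL, which
  the recursion defining \<open>act\<close> requires.\<close>

lemma wf_mem_M: "wf (mem_rel M)"
proof (rule wfUNIVI)
  fix P x
  assume *: "\<forall>x. (\<forall>y. (y, x) \<in> mem_rel M \<longrightarrow> P y) \<longrightarrow> P x"
  have "P x" if "x \<in> cumul K"
    using that
  proof (induction rule: cumul.induct)
    case (atom n)
    show ?case using * elts_M_atom unfolding mem_rel_def by simp
  next
    case (code X)
    then have "elts M (code K X) = X" by (intro elts_M_code) auto
    then show ?case using * code unfolding mem_rel_def by simp
  qed
  then show "P x" using * unfolding mem_rel_def M_simps by blast
qed

text \<open>The numerals are rebuilt with \<open>code\<close>: the numeral zero of \<open>K\<close>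
  is the mark and does not belong to the new universe.\<close>

lemma infinity_M: "\<exists>w. inductive_in M w"
proof -
  define f where "f = rec_nat (code K {}) (\<lambda>n x. code K (insert x (elts M x)))"
  have f0: "f 0 = code K {}" and fS: "f (Suc n) = code K (insert (f n) (elts M (f n)))" for n
    unfolding f_def by simp_all
  have f: "isset M (f n)" for n
  proof (induction n)
    case 0
    then show ?case unfolding f0 isset_M using small_empty by blast
  next
    case (Suc n)
    then have "f n \<in> cumul K" unfolding isset_def M_simps by blast
    then have "small K (insert (f n) (elts M (f n)))" "insert (f n) (elts M (f n)) \<subseteq> cumul K"
      using small_insert[OF cumul_Dom small_elts_M] elts_Dom[of _ M] M_simps by auto
    then show ?case unfolding fS isset_M by blast
  qed
  then have fD: "f n \<in> cumul K" for n unfolding isset_def M_simps by blast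
  have "is_succ M (f n) (f (Suc n))" for n
    unfolding is_succ_def using f[of "Suc n"] fD elts_Dom[of _ M] M_simps
    by (auto simp: fS elts_M_code small_insert small_elts_M cumul_Dom subset_iff)
  moreover have "is_empty M (f 0)"
    unfolding is_empty_def using f[of 0] by (simp add: f0 elts_M_code small_empty)
  moreover have "small K (range f)" using fD cumul_Dom by (intro small_countable) auto
  then obtain w where "isset M w" "elts M w = range f"
    using small_M_ex[of "range f"] fD by auto
  ultimately have "inductive_in M w" unfolding inductive_in_def by simp blast
  then show ?thesis by blast
qed

lemma zfa_univ_M: "zfa_univ M"
proof (unfold_locales, unfold ZFA_basic_def, intro conjI)
  show "Atoms M \<subseteq> Dom M" unfolding M_simps using cumul.atom by blast
  show "\<forall>a \<in> Atoms M. elts M a = {}" unfolding M_simps using elts_M_atom by blast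
  show "\<forall>x y. isset M x \<and> isset M y \<and> elts M x = elts M y \<longrightarrow> x = y"
    unfolding isset_M using elts_M_code by auto
  show "\<exists>A. isset M A \<and> elts M A = Atoms M"
    unfolding M_simps using cumul.atom cumul_Dom
    by (intro small_M_ex small_countable) blast+
  show "\<exists>z. is_empty M z" unfolding is_empty_def using small_M_ex small_empty by blast
  show "\<forall>a \<in> Dom M. \<forall>b \<in> Dom M. \<exists>p. is_upair M a b p"
    unfolding is_upair_def M_simps using small_M_ex small_doubleton cumul_Dom by simp
  show "\<forall>x. isset M x \<longrightarrow> (\<exists>u. isset M u \<and> elts M u = (\<Union>y \<in> elts M x. elts M y))"
  proof (intro allI impI small_M_ex)
    fix x assume x: "isset M x"
    then have "x \<in> cumul K" unfolding isset_def M_simps by blast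
    then show "small K (\<Union>y \<in> elts M x. elts M y)"
      using elts_Dom[of _ M] M_simps by (intro small_UN small_elts_M) auto
    show "(\<Union>y \<in> elts M x. elts M y) \<subseteq> cumul K" using elts_Dom[of _ M] M_simps by auto
  qed
  show "\<forall>x. isset M x \<longrightarrow> (\<exists>p. isset M p \<and> elts M p = {y. isset M y \<and> elts M y \<subseteq> elts M x})"
  proof (intro allI impI small_M_ex)
    fix x assume x: "isset M x"
    let ?P = "{y. isset M y \<and> elts M y \<subseteq> elts M x}"
    let ?Q = "{y. isset K y \<and> elts K y \<subseteq> elts M x}"
    have xK: "small K (elts M x)" using x small_elts_M unfolding isset_def M_simps by blast
    have sub: "elts M x \<subseteq> cumul K" using elts_Dom[of _ M] M_simps by auto
    show PD: "?P \<subseteq> cumul K" unfolding isset_def M_simps by blast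
    \<comment> \<open>A subset in the new sense is the code of a subset in the sense of
      \<open>K\<close>, so the new power set is bounded by an image of an old one.\<close>
    have "?P \<subseteq> (\<lambda>y. code K (elts K y)) ` ?Q"
    proof
      fix y assume y: "y \<in> ?P"
      then obtain Y where Y: "small K Y" "Y \<subseteq> cumul K" "y = code K Y" unfolding isset_M by blast
      then have "mk K Y \<in> ?Q" "y = code K (elts K (mk K Y))"
        using y elts_M_code by (auto simp: isset_mk elts_mk)
      then show "y \<in> (\<lambda>y. code K (elts K y)) ` ?Q" by blast
    qed
    moreover have "small K ((\<lambda>y. code K (elts K y)) ` ?Q)"
    proof (intro small_image small_Pow xK image_subsetI)
      fix y assume "y \<in> ?Q"
      then show "code K (elts K y) \<in> Dom K"
        unfolding code_def by (intro mk_Dom small_mark small_elts) blast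
    qed
    ultimately show "small K ?P" by (rule small_subset[rotated])
  qed
  show "\<exists>w. inductive_in M w" by (rule infinity_M)
  show "\<forall>x. isset M x \<and> elts M x \<noteq> {} \<longrightarrow> (\<exists>y \<in> elts M x. elts M y \<inter> elts M x = {})"
  proof (intro allI impI)
    fix x assume x: "isset M x \<and> elts M x \<noteq> {}"
    then obtain y where y: "y \<in> elts M x" "\<forall>z. (z, y) \<in> mem_rel M \<longrightarrow> z \<notin> elts M x"
      using wf_mem_M unfolding wf_eq_minimal by (metis ex_in_conv)
    then have "elts M y \<inter> elts M x = {}"
      using elts_Dom unfolding mem_rel_def by fast
    with y show "\<exists>y \<in> elts M x. elts M y \<inter> elts M x = {}" by blast
  qed
next
  fix a P assume a: "isset M a"
  then have "small K (elts M a)" using small_elts_M unfolding isset_def M_simps by blast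
  then have "small K {x \<in> elts M a. P x}" by (rule small_subset) blast
  then show "\<exists>b. isset M b \<and> elts M b = {x \<in> elts M a. P x}"
    using elts_Dom[of _ M] M_simps by (intro small_M_ex) auto
next
  fix a F assume a: "isset M a" "F ` elts M a \<subseteq> Dom M"
  then have "small K (elts M a)" using small_elts_M unfolding isset_def M_simps by blast
  then show "\<exists>b. isset M b \<and> elts M b = F ` elts M a"
    using a cumul_Dom unfolding M_simps by (intro small_M_ex small_image) auto
qed

end


section \<open>The second Fraenkel model\<close>

text \<open>The atoms \<open>pt n False\<close> and \<open>pt n True\<close> form the n-th pair. How
  they were constructed is forgotten from here on.\<close>

locale atom_pairs = zfa_univ K for K :: "'v zfa_struct" +
  fixes pt :: "nat \<Rightarrow> bool \<Rightarrow> 'v"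
  assumes wf_mem: "wf (mem_rel K)"
    and pt_inj: "pt m b = pt n c \<longleftrightarrow> m = n \<and> b = c"
    and Atoms_eq: "Atoms K = {pt n b |n b. True}"
begin

text \<open>\<open>S\<close> lists the pairs to be exchanged. The condition
  \<open>b \<noteq> (n \<in> S)\<close> is exclusive or, so composition becomes symmetric difference
  of index sets.\<close>

definition swap :: "nat set \<Rightarrow> 'v \<Rightarrow> 'v" where
  "swap S x = (if x \<in> Atoms K then THE y. \<exists>n b. x = pt n b \<and> y = pt n (b \<noteq> (n \<in> S)) else x)"

abbreviation sdiff :: "nat set \<Rightarrow> nat set \<Rightarrow> nat set" where
  "sdiff S S' \<equiv> (S - S') \<union> (S' - S)"

definition act_swap :: "nat set \<Rightarrow> 'v \<Rightarrow> 'v" where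
  "act_swap S = act K (swap S)"

text \<open>Supports may be taken to be the first m pairs of atoms.\<close>

definition away :: "nat \<Rightarrow> nat set \<Rightarrow> bool" where
  "away m S \<longleftrightarrow> S \<inter> {..<m} = {}"

definition supp :: "nat \<Rightarrow> 'v \<Rightarrow> bool" where
  "supp m x \<longleftrightarrow> (\<forall>S. away m S \<longrightarrow> act_swap S x = x)"

definition fin_supp :: "('v \<Rightarrow> 'v) set set" where
  "fin_supp = {H. H \<subseteq> range swap \<and> perm_group (Atoms K) H \<and> (\<exists>m. \<forall>S. away m S \<longrightarrow> swap S \<in> H)}"

definition HS :: "'v set" where
  "HS = hereditarily_symmetric K (range swap) fin_supp"

definition N :: "'v zfa_struct" where
  "N = K\<lparr>Dom := HS\<rparr>"


subsection \<open>The group and the filter\<close>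

lemma swap_pt: "swap S (pt n b) = pt n (b \<noteq> (n \<in> S))"
proof -
  have "pt n b \<in> Atoms K" unfolding Atoms_eq by blast
  then show ?thesis unfolding swap_def using pt_inj by (auto intro!: the_equality)
qed

lemma swap_other: "x \<notin> Atoms K \<Longrightarrow> swap S x = x"
  unfolding swap_def by simp

lemma swap_swap: "swap S (swap S' x) = swap (sdiff S S') x"
proof (cases "x \<in> Atoms K")
  case True
  then obtain n b where "x = pt n b" unfolding Atoms_eq by blast
  then show ?thesis by (auto simp: swap_pt pt_inj)
qed (simp add: swap_other)

lemma swap_empty: "swap {} x = x"
  by (cases "x \<in> Atoms K") (auto simp: Atoms_eq swap_pt swap_other)

lemma swap_comp: "swap S \<circ> swap S' = swap (sdiff S S')"
  using swap_swap by auto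

lemma swap_empty_id: "swap {} = id"
  using swap_empty by auto

lemma swap_involution: "swap S (swap S x) = x"
  by (simp add: swap_swap swap_empty)

lemma inv_swap: "inv_into UNIV (swap S) = swap S"
  by (rule inv_unique_comp) (auto simp: swap_involution)

lemma swap_permutes: "swap S permutes Atoms K"
  unfolding permutes_def using swap_other swap_involution by metis

lemma swap_Atoms: "x \<in> Atoms K \<Longrightarrow> swap S x \<in> Atoms K"
  using swap_permutes permutes_in_image by metis

lemma away_sdiff: "away m S \<Longrightarrow> away m S' \<Longrightarrow> away m (sdiff S S')"
  unfolding away_def by blast

lemma away_mono: "away n S \<Longrightarrow> m \<le> n \<Longrightarrow> away m S"
  unfolding away_def by force

lemma swap_away: "away (Suc n) S \<Longrightarrow> swap S (pt n b) = pt n b"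
  unfolding away_def swap_pt by (subgoal_tac "n \<notin> S") auto

lemma away_empty: "away m {}"
  unfolding away_def by blast

lemma perm_group_swap: "perm_group (Atoms K) (range swap)"
  unfolding perm_group_def
  using swap_permutes swap_empty_id swap_comp inv_swap by (auto simp: image_iff) metis

text \<open>Closure under inverses comes for free, every \<open>swap S\<close> being its own
  inverse.\<close>

lemma perm_groupI:
  assumes "H \<subseteq> range swap" "id \<in> H" "\<And>\<pi> \<rho>. \<pi> \<in> H \<Longrightarrow> \<rho> \<in> H \<Longrightarrow> \<pi> \<circ> \<rho> \<in> H"
  shows "perm_group (Atoms K) H"
  unfolding perm_group_def
proof (intro conjI ballI)
  fix \<pi> assume \<pi>: "\<pi> \<in> H"
  then obtain S where "\<pi> = swap S" using assms(1) by blast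
  then show "\<pi> permutes Atoms K" "inv_into UNIV \<pi> \<in> H"
    using \<pi> swap_permutes inv_swap by auto
qed (use assms in auto)

text \<open>The group is abelian, and with this the conjugation clause of
  \<open>normal_filter\<close> becomes trivial.\<close>

lemma swap_conj: "swap S \<circ> swap S' \<circ> inv_into UNIV (swap S) = swap S'"
proof -
  have "sdiff (sdiff S S') S = S'" by blast
  then show ?thesis by (simp only: inv_swap swap_comp)
qed

lemma fin_supp_stabilizer:
  assumes "\<And>S S'. P (swap S) \<Longrightarrow> P (swap S') \<Longrightarrow> P (swap S \<circ> swap S')"
    and "\<And>S. away m S \<Longrightarrow> P (swap S)"
  shows "{\<pi> \<in> range swap. P \<pi>} \<in> fin_supp"
proof -
  have "perm_group (Atoms K) {\<pi> \<in> range swap. P \<pi>}"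
  proof (rule perm_groupI)
    have "P (swap {})" by (rule assms(2)) (rule away_empty)
    moreover have "id \<in> range swap" using swap_empty_id by (metis rangeI)
    ultimately show "id \<in> {\<pi> \<in> range swap. P \<pi>}" by (simp add: swap_empty_id)
  next
    fix \<pi> \<rho> assume "\<pi> \<in> {\<pi> \<in> range swap. P \<pi>}" "\<rho> \<in> {\<pi> \<in> range swap. P \<pi>}"
    then obtain S S' where S: "\<pi> = swap S" "P (swap S)" "\<rho> = swap S'" "P (swap S')" by blast
    then have "P (\<pi> \<circ> \<rho>)" using assms(1) by simp
    then show "\<pi> \<circ> \<rho> \<in> {\<pi> \<in> range swap. P \<pi>}" using S by (simp add: swap_comp)
  qed blast
  then show ?thesis unfolding fin_supp_def using assms(2) by auto
qed

lemma normal_filter_fin_supp: "normal_filter (Atoms K) (range swap) fin_supp"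
  unfolding normal_filter_def
proof (intro conjI ballI allI impI)
  show "range swap \<in> fin_supp" unfolding fin_supp_def using perm_group_swap by blast
next
  fix H J assume "H \<in> fin_supp \<and> H \<subseteq> J \<and> J \<subseteq> range swap \<and> perm_group (Atoms K) J"
  then show "J \<in> fin_supp" unfolding fin_supp_def by blast
next
  fix H J assume H: "H \<in> fin_supp" and J: "J \<in> fin_supp"
  then obtain m n where "\<forall>S. away m S \<longrightarrow> swap S \<in> H" "\<forall>S. away n S \<longrightarrow> swap S \<in> J"
    unfolding fin_supp_def by blast
  then have "\<forall>S. away (max m n) S \<longrightarrow> swap S \<in> H \<inter> J"
    using away_mono by (meson IntI max.cobounded1 max.cobounded2)
  moreover have "perm_group (Atoms K) (H \<inter> J)"
    using H J unfolding fin_supp_def perm_group_def by simp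
  ultimately show "H \<inter> J \<in> fin_supp" using H unfolding fin_supp_def by blast
next
  fix \<pi> H assume \<pi>: "\<pi> \<in> range swap" and H: "H \<in> fin_supp"
  then have "(\<lambda>h. \<pi> \<circ> h \<circ> inv_into UNIV \<pi>) ` H = (\<lambda>h. h) ` H"
    unfolding fin_supp_def by (intro image_cong refl) (auto simp: swap_conj)
  then show "(\<lambda>h. \<pi> \<circ> h \<circ> inv_into UNIV \<pi>) ` H \<in> fin_supp" using H by simp
next
  fix a assume "a \<in> Atoms K"
  then obtain n b where "a = pt n b" unfolding Atoms_eq by blast
  then show "{\<pi> \<in> range swap. \<pi> a = a} \<in> fin_supp"
    by (intro fin_supp_stabilizer[where m = "Suc n"]) (auto simp: swap_away swap_swap[symmetric])
qed (auto simp: fin_supp_def)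


subsection \<open>The action on the universe\<close>

lemma mem_induct [consumes 1]:
  assumes "x \<in> Dom K" "\<And>x. x \<in> Dom K \<Longrightarrow> (\<And>y. y \<in> elts K x \<Longrightarrow> P y) \<Longrightarrow> P x"
  shows "P x"
proof -
  have "x \<in> Dom K \<longrightarrow> P x"
  proof (rule wf_induct_rule[OF wf_mem])
    fix x assume IH: "\<And>y. (y, x) \<in> mem_rel K \<Longrightarrow> y \<in> Dom K \<longrightarrow> P y"
    show "x \<in> Dom K \<longrightarrow> P x"
    proof
      assume x: "x \<in> Dom K"
      show "P x"
      proof (rule assms(2)[OF x])
        fix y assume y: "y \<in> elts K x"
        then have "(y, x) \<in> mem_rel K" unfolding mem_rel_def using x by simp
        then show "P y" using IH elts_Dom[OF y] by blast
      qed
    qed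
  qed
  then show ?thesis using assms(1) by blast
qed

lemma elts_Atoms: "a \<in> Atoms K \<Longrightarrow> elts K a = {}"
  using basic unfolding ZFA_basic_def by (elim conjE) simp

lemma Atoms_Dom: "a \<in> Atoms K \<Longrightarrow> a \<in> Dom K"
  using basic unfolding ZFA_basic_def by (elim conjE) blast

lemma act_swap_atom: "x \<in> Atoms K \<Longrightarrow> act_swap S x = swap S x"
  unfolding act_swap_def act_def by (subst wfrec[OF wf_mem]) simp

lemma act_swap_mk: "isset K x \<Longrightarrow> act_swap S x = mk K (act_swap S ` elts K x)"
proof -
  assume x: "isset K x"
  let ?H = "\<lambda>h x. if x \<in> Atoms K then swap S x else (THE z. isset K z \<and> elts K z = h ` elts K x)"
  \<comment> \<open>\<open>wfrec\<close> passes its recursive calls through \<open>cut\<close>,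
    which changes nothing on the members of \<open>x\<close>.\<close>
  have "cut (wfrec (mem_rel K) ?H) (mem_rel K) x ` elts K x = wfrec (mem_rel K) ?H ` elts K x"
    by (intro image_cong refl cut_apply) (use x isset_Dom in \<open>auto simp: mem_rel_def\<close>)
  then show ?thesis
    unfolding act_swap_def act_def mk_def
    by (subst wfrec[OF wf_mem]) (use x in \<open>simp add: isset_def\<close>)
qed

lemma act_swap_Dom: "x \<in> Dom K \<Longrightarrow> act_swap S x \<in> Dom K"
proof (induction rule: mem_induct)
  case (1 x)
  show ?case
  proof (cases "x \<in> Atoms K")
    case True
    then show ?thesis using act_swap_atom swap_Atoms Atoms_Dom by simp
  next
    case False
    then have "isset K x" using 1 by (simp add: isset_def)
    moreover then have "small K (act_swap S ` elts K x)"
      using 1 by (intro small_image small_elts) auto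
    ultimately show ?thesis using act_swap_mk mk_Dom by simp
  qed
qed

lemma small_act_swap:
  assumes "small K X"
  shows "small K (act_swap S ` X)"
  using assms act_swap_Dom small_subset_Dom[OF assms] by (intro small_image) auto

lemma isset_act_swap: "isset K x \<Longrightarrow> isset K (act_swap S x)"
  using act_swap_mk isset_mk[OF small_act_swap[OF small_elts]] by simp

lemma elts_act_swap: "x \<in> Dom K \<Longrightarrow> elts K (act_swap S x) = act_swap S ` elts K x"
  by (cases "x \<in> Atoms K")
    (simp_all add: act_swap_atom swap_Atoms elts_Atoms act_swap_mk elts_mk small_act_swap
      small_elts isset_def)

lemma act_swap_swap: "x \<in> Dom K \<Longrightarrow> act_swap S (act_swap S' x) = act_swap (sdiff S S') x"
proof (induction rule: mem_induct)
  case (1 x)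
  show ?case
  proof (cases "x \<in> Atoms K")
    case True
    then show ?thesis by (simp add: act_swap_atom swap_Atoms swap_swap)
  next
    case False
    then have x: "isset K x" using 1 by (simp add: isset_def)
    have "act_swap S ` act_swap S' ` elts K x = act_swap (sdiff S S') ` elts K x"
      unfolding image_image using 1 by (intro image_cong refl) simp
    then show ?thesis
      using act_swap_mk[OF x] act_swap_mk[OF isset_act_swap[OF x]] elts_act_swap[OF isset_Dom[OF x]]
      by simp
  qed
qed

lemma act_swap_empty: "x \<in> Dom K \<Longrightarrow> act_swap {} x = x"
proof (induction rule: mem_induct)
  case (1 x)
  show ?case
  proof (cases "x \<in> Atoms K")
    case True
    then show ?thesis by (simp add: act_swap_atom swap_empty)
  next
    case False
    then have x: "isset K x" using 1 by (simp add: isset_def)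
    have "act_swap {} ` elts K x = elts K x" using 1 by simp
    then show ?thesis using act_swap_mk[OF x] mk_eqI[OF x refl] by simp
  qed
qed

lemma act_swap_involution: "x \<in> Dom K \<Longrightarrow> act_swap S (act_swap S x) = x"
  by (simp add: act_swap_swap act_swap_empty)

lemma act_swap_commute: "x \<in> Dom K \<Longrightarrow> act_swap S (act_swap S' x) = act_swap S' (act_swap S x)"
  by (simp add: act_swap_swap Un_commute)

lemma act_swap_inj: "x \<in> Dom K \<Longrightarrow> y \<in> Dom K \<Longrightarrow> act_swap S x = act_swap S y \<longleftrightarrow> x = y"
  using act_swap_involution by metis

lemma act_swap_mk_image: "small K X \<Longrightarrow> act_swap S (mk K X) = mk K (act_swap S ` X)"
  using act_swap_mk isset_mk elts_mk by simp


subsection \<open>Hereditarily symmetric elements\<close>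

lemma supp_mono: "supp m x \<Longrightarrow> m \<le> n \<Longrightarrow> supp n x"
  unfolding supp_def using away_mono by blast

text \<open>Commutativity of the group is what keeps \<open>m\<close>; in a general permutation
  model the support would have to be moved along with \<open>x\<close>.\<close>

lemma supp_act_swap: "x \<in> Dom K \<Longrightarrow> supp m x \<Longrightarrow> supp m (act_swap S x)"
  unfolding supp_def using act_swap_commute by metis

lemma symmetric_iff:
  assumes "x \<in> Dom K"
  shows "symmetric K (range swap) fin_supp x \<longleftrightarrow> (\<exists>m. supp m x)"
proof
  assume "symmetric K (range swap) fin_supp x"
  then show "\<exists>m. supp m x"
    unfolding symmetric_def fin_supp_def supp_def act_swap_def by blast
next
  assume "\<exists>m. supp m x"
  then obtain m where m: "supp m x" by blast
  show "symmetric K (range swap) fin_supp x"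
    unfolding symmetric_def
  proof (rule fin_supp_stabilizer[where m = m])
    fix S S' assume "act K (swap S) x = x" "act K (swap S') x = x"
    then show "act K (swap S \<circ> swap S') x = x"
      using act_swap_swap[OF assms, of S S'] unfolding swap_comp act_swap_def by simp
  qed (use m in \<open>auto simp: supp_def act_swap_def\<close>)
qed

text \<open>Trades the transitive closure in the definition for a one-step recursion, the form in
  which membership in the model is always checked.\<close>

lemma HS_iff: "x \<in> HS \<longleftrightarrow> x \<in> Dom K \<and> (\<exists>m. supp m x) \<and> elts K x \<subseteq> HS"
proof
  assume "x \<in> HS"
  then have x: "x \<in> Dom K" and sym: "\<And>y. (y, x) \<in> (mem_rel K)\<^sup>* \<Longrightarrow> symmetric K (range swap) fin_supp y"
    unfolding HS_def hereditarily_symmetric_def by auto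
  have "y \<in> HS" if y: "y \<in> elts K x" for y
  proof -
    have "(y, x) \<in> mem_rel K" using x y unfolding mem_rel_def by simp
    then show ?thesis
      unfolding HS_def hereditarily_symmetric_def using sym elts_Dom[OF y]
      by (auto intro: rtrancl_into_rtrancl)
  qed
  then show "x \<in> Dom K \<and> (\<exists>m. supp m x) \<and> elts K x \<subseteq> HS"
    using x sym[of x] symmetric_iff by auto
next
  assume x: "x \<in> Dom K \<and> (\<exists>m. supp m x) \<and> elts K x \<subseteq> HS"
  have "symmetric K (range swap) fin_supp y" if "(y, x) \<in> (mem_rel K)\<^sup>*" for y
    using that
  proof (cases rule: rtranclE)
    case base
    then show ?thesis using x symmetric_iff by simp
  next
    case (step z)
    then have "z \<in> HS" using x unfolding mem_rel_def by blast
    then show ?thesis using step unfolding HS_def hereditarily_symmetric_def by blast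
  qed
  then show "x \<in> HS" unfolding HS_def hereditarily_symmetric_def using x by blast
qed

lemma HS_Dom: "x \<in> HS \<Longrightarrow> x \<in> Dom K"
  using HS_iff by blast

lemma HS_supp: "x \<in> HS \<Longrightarrow> \<exists>m. supp m x"
  using HS_iff by blast

lemma HS_elts: "x \<in> HS \<Longrightarrow> y \<in> elts K x \<Longrightarrow> y \<in> HS"
  using HS_iff by blast

text \<open>Supports are initial segments, so the maximum of finitely many bounds serves all. Every
  later appeal to finiteness of parameters, colours or scalars passes through here.\<close>

lemma HS_finite_supp:
  assumes "finite X" "X \<subseteq> HS"
  shows "\<exists>m. \<forall>x \<in> X. supp m x"
  using assms
proof (induction rule: finite_induct)
  case (insert x X)
  then obtain m n where "supp m x" "\<forall>y \<in> X. supp n y" using HS_supp by blast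
  then have "\<forall>y \<in> insert x X. supp (max m n) y"
    using supp_mono max.cobounded1 max.cobounded2 by blast
  then show ?case by blast
qed simp

lemma act_swap_HS:
  assumes "x \<in> HS"
  shows "act_swap S x \<in> HS"
proof -
  have "x \<in> HS \<longrightarrow> act_swap S x \<in> HS"
    using HS_Dom[OF assms]
  proof (induction rule: mem_induct)
    case (1 x)
    show ?case
    proof
      assume x: "x \<in> HS"
      then have "act_swap S ` elts K x \<subseteq> HS" using 1 HS_elts by blast
      moreover have "\<exists>m. supp m (act_swap S x)" using HS_supp[OF x] supp_act_swap 1 by blast
      ultimately show "act_swap S x \<in> HS"
        using HS_iff[of "act_swap S x"] act_swap_Dom elts_act_swap 1 by simp
    qed
  qed
  with assms show ?thesis by blast
qed

lemma pt_supp: "supp (Suc n) (pt n b)"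
proof -
  have "pt n b \<in> Atoms K" unfolding Atoms_eq by blast
  then show ?thesis unfolding supp_def by (simp add: act_swap_atom swap_away)
qed

lemma Atoms_HS: "Atoms K \<subseteq> HS"
proof
  fix a assume a: "a \<in> Atoms K"
  then have "\<exists>m. supp m a" using pt_supp unfolding Atoms_eq by blast
  with a show "a \<in> HS" using HS_iff[of a] by (simp add: Atoms_Dom elts_Atoms)
qed

lemma N_simps: "Dom N = HS" "Atoms N = Atoms K"
  unfolding N_def by simp_all

lemma elts_N: "x \<in> HS \<Longrightarrow> elts N x = elts K x"
  using HS_elts[of x] HS_Dom unfolding elts_def N_def by auto

lemma isset_N: "isset N x \<longleftrightarrow> isset K x \<and> x \<in> HS"
  unfolding isset_def N_simps using HS_Dom by blast

text \<open>For an involution, mapping \<open>X\<close> into itself already means mapping it onto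
  itself.\<close>

lemma invariant_eq:
  assumes "X \<subseteq> Dom K" "\<And>x. x \<in> X \<Longrightarrow> act_swap S x \<in> X"
  shows "act_swap S ` X = X"
proof (intro equalityI subsetI)
  fix x assume "x \<in> X"
  then show "x \<in> act_swap S ` X"
    using assms act_swap_involution[of x S] by (metis image_eqI subsetD)
qed (use assms in auto)

text \<open>The entrance to the model: for a coded set of its elements, closure under the swaps away
  from one fixed \<open>m\<close> is all that has to be checked.\<close>

lemma N_setI:
  assumes "small K X" "X \<subseteq> HS" "\<And>S x. away m S \<Longrightarrow> x \<in> X \<Longrightarrow> act_swap S x \<in> X"
  shows "isset N (mk K X)" "elts N (mk K X) = X"
proof -
  have "supp m (mk K X)"
    unfolding supp_def
  proof (intro allI impI)
    fix S assume "away m S"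
    then have "act_swap S ` X = X"
      using assms(2,3) HS_Dom by (intro invariant_eq) auto
    then show "act_swap S (mk K X) = mk K X" using act_swap_mk_image[OF assms(1)] by simp
  qed
  then have "mk K X \<in> HS"
    using HS_iff[of "mk K X"] mk_Dom[OF assms(1)] elts_mk[OF assms(1)] assms(2) by auto
  then show "isset N (mk K X)" "elts N (mk K X) = X"
    using isset_N isset_mk[OF assms(1)] elts_N elts_mk[OF assms(1)] by auto
qed

lemma small_NI:
  assumes "small K X" "X \<subseteq> HS" "\<And>S x. away m S \<Longrightarrow> x \<in> X \<Longrightarrow> act_swap S x \<in> X"
  shows "small N X"
  unfolding small_def using N_setI[of X m] assms by blast

lemma small_N_K: "small N X \<Longrightarrow> small K X"
  unfolding small_def isset_N using elts_N by metis

lemma permutation_model_N: "permutation_model N"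
  unfolding permutation_model_def
  by (intro exI[of _ K] exI[of _ "range swap"] exI[of _ fin_supp] conjI zfac_universeI
      perm_group_swap normal_filter_fin_supp) (simp add: N_def HS_def)

end


subsection \<open>The axioms of ZFA in the model\<close>

text \<open>Bound variables are included, so this only bounds the free ones. Its finiteness leaves
  finitely many parameters, which then have a common support.\<close>

primrec vars :: "fm \<Rightarrow> nat set" where
  "vars (FMem i j) = {i, j}"
| "vars (FEq i j) = {i, j}"
| "vars (FAtom i) = {i}"
| "vars (FNeg p) = vars p"
| "vars (FConj p q) = vars p \<union> vars q"
| "vars (FAll i p) = insert i (vars p)"

lemma finite_vars: "finite (vars p)"
  by (induction p) auto

lemma sat_cong: "(\<And>i. i \<in> vars p \<Longrightarrow> e i = e' i) \<Longrightarrow> sat M p e \<longleftrightarrow> sat M p e'"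
proof (induction p arbitrary: e e')
  case (FAll i p)
  have "sat M p (e(i := a)) \<longleftrightarrow> sat M p (e'(i := a))" for a
    by (rule FAll.IH) (use FAll.prems in auto)
  then show ?case by simp
next
  case (FConj p q)
  have "sat M p e \<longleftrightarrow> sat M p e'" "sat M q e \<longleftrightarrow> sat M q e'"
    by (rule FConj.IH; use FConj.prems in simp)+
  then show ?case by simp
next
  case (FNeg p)
  have "sat M p e \<longleftrightarrow> sat M p e'" by (rule FNeg.IH) (use FNeg.prems in simp)
  then show ?case by simp
qed auto

context atom_pairs
begin

lemma supp_elts:
  assumes "x \<in> HS" "supp m x" "away m S" "y \<in> elts K x"
  shows "act_swap S y \<in> elts K x"
proof -
  have "act_swap S x = x" using assms unfolding supp_def by blast
  then show ?thesis using elts_act_swap[OF HS_Dom[OF assms(1)], of S] assms(4) by auto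
qed

lemma act_swap_elts_iff:
  assumes "x \<in> HS" "y \<in> HS"
  shows "act_swap S x \<in> elts K (act_swap S y) \<longleftrightarrow> x \<in> elts K y"
  unfolding elts_act_swap[OF HS_Dom[OF assms(2)]]
  using act_swap_inj[OF HS_Dom[OF assms(1)]] by (auto dest: elts_Dom)

text \<open>Every \<open>act_swap S\<close> is an automorphism of \<open>N\<close> for membership,
  equality and the atom predicate, and hence preserves the truth of formulas.\<close>

lemma sat_act_swap:
  assumes "range e \<subseteq> HS"
  shows "sat N p (\<lambda>i. act_swap S (e i)) \<longleftrightarrow> sat N p e"
  using assms
proof (induction p arbitrary: e)
  case (FMem i j)
  then have e: "e i \<in> HS" "e j \<in> HS" by auto
  have "Mem N x y \<longleftrightarrow> x \<in> elts K y" if "x \<in> HS" for x y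
    using HS_Dom[OF that] unfolding elts_def N_def by simp
  then show ?case using e act_swap_HS act_swap_elts_iff by simp
next
  case (FEq i j)
  then have "e i \<in> Dom K" "e j \<in> Dom K" using HS_Dom by auto
  then show ?case using act_swap_inj by simp
next
  case (FAtom i)
  then have e: "e i \<in> Dom K" using HS_Dom by auto
  have "act_swap S x \<in> Atoms K" if "x \<in> Atoms K" for x
    using that act_swap_atom swap_Atoms by simp
  then show ?case using act_swap_involution[OF e] unfolding N_simps sat.simps by metis
next
  case (FAll i p)
  have IH: "sat N p (\<lambda>j. act_swap S ((e(i := a)) j)) \<longleftrightarrow> sat N p (e(i := a))" if "a \<in> HS" for a
    by (rule FAll.IH) (use FAll.prems that in auto)
  have upd: "(\<lambda>j. act_swap S ((e(i := a)) j)) = (\<lambda>j. act_swap S (e j))(i := act_swap S a)" for a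
    by auto
  \<comment> \<open>The quantifier is reindexed along the involution, which maps \<open>HS\<close>
    onto itself.\<close>
  have "(\<forall>a \<in> HS. sat N p ((\<lambda>j. act_swap S (e j))(i := a))) \<longleftrightarrow>
      (\<forall>a \<in> HS. sat N p ((\<lambda>j. act_swap S (e j))(i := act_swap S a)))"
    using act_swap_HS act_swap_involution HS_Dom by metis
  also have "\<dots> \<longleftrightarrow> (\<forall>a \<in> HS. sat N p (e(i := a)))" using IH unfolding upd by blast
  finally show ?case unfolding sat.simps N_simps .
qed simp_all

lemma sat_supp:
  assumes "range e \<subseteq> HS" "x \<in> HS" "y \<in> HS" "\<forall>z \<in> e ` vars p. supp m z" "away m S"
  shows "sat N p (e(0 := x)) \<Longrightarrow> sat N p (e(0 := act_swap S x))"
    and "sat N p (e(0 := x, 1 := y)) \<Longrightarrow> sat N p (e(0 := act_swap S x, 1 := act_swap S y))"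
proof -
  have fixed: "act_swap S (e i) = e i" if "i \<in> vars p" for i
    using assms that unfolding supp_def by blast
  have "sat N p (e(0 := act_swap S x)) \<longleftrightarrow> sat N p (\<lambda>i. act_swap S ((e(0 := x)) i))"
    by (rule sat_cong) (use fixed in auto)
  moreover have "sat N p (\<lambda>i. act_swap S ((e(0 := x)) i)) \<longleftrightarrow> sat N p (e(0 := x))"
    by (rule sat_act_swap) (use assms in auto)
  ultimately show "sat N p (e(0 := x)) \<Longrightarrow> sat N p (e(0 := act_swap S x))" by simp
  have "sat N p (e(0 := act_swap S x, 1 := act_swap S y)) \<longleftrightarrow>
      sat N p (\<lambda>i. act_swap S ((e(0 := x, 1 := y)) i))"
    by (rule sat_cong) (use fixed in auto)
  moreover have "sat N p (\<lambda>i. act_swap S ((e(0 := x, 1 := y)) i)) \<longleftrightarrow> sat N p (e(0 := x, 1 := y))"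
    by (rule sat_act_swap) (use assms in auto)
  ultimately show "sat N p (e(0 := x, 1 := y)) \<Longrightarrow> sat N p (e(0 := act_swap S x, 1 := act_swap S y))"
    by simp
qed

text \<open>Numerals are built from the empty set alone. Their invariance makes colours and indices
  insensitive to swaps later on.\<close>

lemma act_swap_num: "act_swap S (num K n) = num K n"
proof (induction n)
  case 0
  then show ?case by (simp add: act_swap_mk_image small_empty)
next
  case (Suc n)
  have "act_swap S ` elts K (num K n) = elts K (num K n)"
    using elts_act_swap[OF num_Dom, of S n] Suc by simp
  then show ?case
    using Suc by (simp add: act_swap_mk_image small_insert num_Dom small_elts isset_num)
qed

lemma num_HS: "num K n \<in> HS"
proof (induction n rule: less_induct)
  case (less n)
  then show ?case
    using HS_iff[of "num K n"] num_Dom act_swap_num unfolding supp_def by (auto simp: elts_num)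
qed

lemma small_range_num_K: "small K (range (num K))"
  using num_Dom by (intro small_countable) auto

lemma small_N_doubleton:
  assumes "a \<in> HS" "b \<in> HS"
  shows "small N {a, b}"
proof -
  obtain m where m: "\<forall>x \<in> {a, b}. supp m x"
    using HS_finite_supp[of "{a, b}"] assms by auto
  show ?thesis
    by (rule small_NI[where m = m])
      (use assms m in \<open>auto simp: small_doubleton HS_Dom supp_def\<close>)
qed

lemma ZFA_basic_N: "ZFA_basic N"
  unfolding ZFA_basic_def
proof (intro conjI)
  show "Atoms N \<subseteq> Dom N" unfolding N_simps by (rule Atoms_HS)
  show "\<forall>a \<in> Atoms N. elts N a = {}"
    unfolding N_simps using Atoms_HS elts_Atoms elts_N by auto
  show "\<forall>x y. isset N x \<and> isset N y \<and> elts N x = elts N y \<longrightarrow> x = y"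
    unfolding isset_N using elts_N elts_eqI by auto
  have "\<exists>A. isset K A \<and> elts K A = Atoms K"
    using basic unfolding ZFA_basic_def by (elim conjE)
  then have "small N (Atoms K)"
    using Atoms_HS act_swap_atom swap_Atoms
    by (intro small_NI[where m = 0]) (auto simp: small_def)
  then show "\<exists>A. isset N A \<and> elts N A = Atoms N" unfolding small_def N_simps .
  have "small N {}" by (rule small_NI[where m = 0]) (auto simp: small_empty)
  then show "\<exists>z. is_empty N z" unfolding small_def is_empty_def .
  show "\<forall>a \<in> Dom N. \<forall>b \<in> Dom N. \<exists>p. is_upair N a b p"
    using small_N_doubleton unfolding is_upair_def N_simps small_def by simp
  show "\<forall>x. isset N x \<longrightarrow> (\<exists>u. isset N u \<and> elts N u = (\<Union>y \<in> elts N x. elts N y))"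
  proof (intro allI impI)
    fix x assume x: "isset N x"
    then have xH: "x \<in> HS" unfolding isset_N by blast
    then obtain m where m: "supp m x" using HS_supp by blast
    have eq: "(\<Union>y \<in> elts N x. elts N y) = (\<Union>y \<in> elts K x. elts K y)"
      using elts_N xH HS_elts by simp
    have "small N (\<Union>y \<in> elts K x. elts K y)"
    proof (rule small_NI[where m = m])
      show "small K (\<Union>y \<in> elts K x. elts K y)" using small_Union x isset_N by blast
      show "(\<Union>y \<in> elts K x. elts K y) \<subseteq> HS" using xH HS_elts by blast
      fix S z assume S: "away m S" and "z \<in> (\<Union>y \<in> elts K x. elts K y)"
      then obtain y where y: "y \<in> elts K x" "z \<in> elts K y" by blast
      then have "act_swap S z \<in> elts K (act_swap S y)"
        using act_swap_elts_iff[of z y S] xH HS_elts by blast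
      moreover have "act_swap S y \<in> elts K x" using supp_elts[OF xH m S y(1)] .
      ultimately show "act_swap S z \<in> (\<Union>y \<in> elts K x. elts K y)" by blast
    qed
    then show "\<exists>u. isset N u \<and> elts N u = (\<Union>y \<in> elts N x. elts N y)"
      unfolding small_def eq .
  qed
  show "\<forall>x. isset N x \<longrightarrow> (\<exists>p. isset N p \<and> elts N p = {y. isset N y \<and> elts N y \<subseteq> elts N x})"
  proof (intro allI impI)
    fix x assume x: "isset N x"
    then have xH: "x \<in> HS" and xK: "isset K x" unfolding isset_N by auto
    then obtain m where m: "supp m x" using HS_supp by blast
    have eq: "{y. isset N y \<and> elts N y \<subseteq> elts N x} = {y \<in> HS. isset K y \<and> elts K y \<subseteq> elts K x}"
      unfolding isset_N using elts_N[OF xH] elts_N by auto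
    have "small N {y \<in> HS. isset K y \<and> elts K y \<subseteq> elts K x}"
    proof (rule small_NI[where m = m])
      show "small K {y \<in> HS. isset K y \<and> elts K y \<subseteq> elts K x}"
        by (rule small_subset[OF small_Pow[OF small_elts[OF xK]]]) blast
      fix S y assume S: "away m S" and y: "y \<in> {y \<in> HS. isset K y \<and> elts K y \<subseteq> elts K x}"
      then have "elts K (act_swap S y) \<subseteq> elts K x"
        using supp_elts[OF xH m S] elts_act_swap[of y S] HS_Dom by auto
      then show "act_swap S y \<in> {y \<in> HS. isset K y \<and> elts K y \<subseteq> elts K x}"
        using y act_swap_HS isset_act_swap by blast
    qed blast
    then show "\<exists>p. isset N p \<and> elts N p = {y. isset N y \<and> elts N y \<subseteq> elts N x}"
      unfolding small_def eq .
  qed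
  have "small N (range (num K))"
    using num_HS act_swap_num by (intro small_NI[where m = 0] small_range_num_K) auto
  then obtain w where w: "isset N w" "elts N w = range (num K)" unfolding small_def by blast
  have num: "isset N (num K n)" "elts N (num K n) = elts K (num K n)" for n
    unfolding isset_N using isset_num num_HS elts_N by auto
  have "is_succ N (num K n) (num K (Suc n))" for n
    unfolding is_succ_def using num[of "Suc n"] num(2)[of n]
    by (simp add: elts_mk small_insert num_Dom small_elts isset_num)
  moreover have "is_empty N (num K 0)"
    unfolding is_empty_def using num[of 0] by (simp add: elts_mk small_empty)
  ultimately have "inductive_in N w" unfolding inductive_in_def w(2) using w(1) by blast
  then show "\<exists>w. inductive_in N w" by blast
  show "\<forall>x. isset N x \<and> elts N x \<noteq> {} \<longrightarrow> (\<exists>y \<in> elts N x. elts N y \<inter> elts N x = {})"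
  proof (intro allI impI)
    fix x assume x: "isset N x \<and> elts N x \<noteq> {}"
    then have xH: "x \<in> HS" and xK: "isset K x" unfolding isset_N by auto
    then obtain y where "y \<in> elts K x" "elts K y \<inter> elts K x = {}"
      using x elts_N[OF xH] foundation[rule_format, of x] by auto
    moreover then have "elts N y = elts K y" using elts_N HS_elts[OF xH] by blast
    ultimately show "\<exists>y \<in> elts N x. elts N y \<inter> elts N x = {}" using elts_N[OF xH] by auto
  qed
qed

lemma separation_N: "separation_schema N"
  unfolding separation_schema_def
proof (intro allI impI)
  fix \<phi> a and e :: "nat \<Rightarrow> 'v"
  assume ea: "range e \<subseteq> Dom N \<and> isset N a"
  then have e: "range e \<subseteq> HS" and aH: "a \<in> HS" and aK: "isset K a"
    unfolding N_simps isset_N by auto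
  have "\<exists>m. \<forall>x \<in> insert a (e ` vars \<phi>). supp m x"
    by (rule HS_finite_supp) (use e aH finite_vars in auto)
  then obtain m where m: "supp m a" "\<forall>x \<in> e ` vars \<phi>. supp m x" by blast
  have "small N {x \<in> elts K a. sat N \<phi> (e(0 := x))}"
  proof (rule small_NI[where m = m])
    show "small K {x \<in> elts K a. sat N \<phi> (e(0 := x))}"
      by (rule small_subset[OF small_elts[OF aK]]) blast
    show "{x \<in> elts K a. sat N \<phi> (e(0 := x))} \<subseteq> HS" using HS_elts[OF aH] by blast
    fix S x assume "away m S" "x \<in> {x \<in> elts K a. sat N \<phi> (e(0 := x))}"
    then show "act_swap S x \<in> {x \<in> elts K a. sat N \<phi> (e(0 := x))}"
      using supp_elts[OF aH m(1)] sat_supp(1)[OF e _ aH m(2)] HS_elts[OF aH] by blast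
  qed
  then show "\<exists>b. isset N b \<and> elts N b = {x \<in> elts N a. sat N \<phi> (e(0 := x))}"
    unfolding small_def elts_N[OF aH] .
qed

lemma replacement_N: "replacement_schema N"
  unfolding replacement_schema_def
proof (intro allI impI, elim conjE)
  fix \<phi> a and e :: "nat \<Rightarrow> 'v"
  assume e: "range e \<subseteq> Dom N" and a: "isset N a"
    and total: "\<forall>x \<in> elts N a. \<exists>!y. y \<in> Dom N \<and> sat N \<phi> (e(0 := x, 1 := y))"
  then have e: "range e \<subseteq> HS" and aH: "a \<in> HS" and aK: "isset K a"
    unfolding N_simps isset_N by auto
  have "\<exists>m. \<forall>x \<in> insert a (e ` vars \<phi>). supp m x"
    by (rule HS_finite_supp) (use e aH finite_vars in auto)
  then obtain m where m: "supp m a" "\<forall>x \<in> e ` vars \<phi>. supp m x" by blast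
  let ?Y = "{y \<in> HS. \<exists>x \<in> elts K a. sat N \<phi> (e(0 := x, 1 := y))}"
  have "small N ?Y"
  proof (rule small_NI[where m = m])
    define F where "F x = (THE y. y \<in> HS \<and> sat N \<phi> (e(0 := x, 1 := y)))" for x
    have ex1: "\<exists>!y. y \<in> HS \<and> sat N \<phi> (e(0 := x, 1 := y))" if "x \<in> elts K a" for x
      using total that unfolding N_simps elts_N[OF aH] by blast
    have F: "F x \<in> HS" if "x \<in> elts K a" for x
      unfolding F_def using theI'[OF ex1[OF that]] by blast
    have Feq: "y = F x" if "x \<in> elts K a" "y \<in> HS" "sat N \<phi> (e(0 := x, 1 := y))" for x y
      unfolding F_def using the1_equality[OF ex1[OF that(1)]] that by metis
    \<comment> \<open>Functionality of the formula bounds \<open>?Y\<close> by an image coded in the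
      ambient universe; invariance, shown next, then brings it into the model.\<close>
    have "?Y \<subseteq> F ` elts K a" using Feq by blast
    moreover have "small K (F ` elts K a)"
      using F HS_Dom by (intro small_image small_elts aK) auto
    ultimately show "small K ?Y" by (rule small_subset[rotated])
    fix S y assume S: "away m S" and "y \<in> ?Y"
    then obtain x where "y \<in> HS" "x \<in> elts K a" "sat N \<phi> (e(0 := x, 1 := y))" by blast
    moreover then have "sat N \<phi> (e(0 := act_swap S x, 1 := act_swap S y))"
      using sat_supp(2)[OF e _ _ m(2) S] HS_elts[OF aH] by blast
    ultimately show "act_swap S y \<in> ?Y"
      using supp_elts[OF aH m(1) S] act_swap_HS by blast
  qed blast
  then show "\<exists>b. isset N b \<and> elts N b =
      {y \<in> Dom N. \<exists>x \<in> elts N a. sat N \<phi> (e(0 := x, 1 := y))}"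
    unfolding small_def N_simps elts_N[OF aH] .
qed

lemma ZFA_N: "ZFA N"
  unfolding ZFA_def using ZFA_basic_N separation_N replacement_N by blast


subsection \<open>Functions and relations in the model\<close>

sublocale N: zfa_basic N
  by unfold_locales (rule ZFA_basic_N)

text \<open>Codes, and with them numerals, are the same whether formed in the model or in the
  ambient universe.\<close>

lemma mk_N: "small N X \<Longrightarrow> mk N X = mk K X"
  using N.isset_mk[of X] N.elts_mk[of X] mk_eqI elts_N unfolding isset_N by metis

lemma num_N: "num N n = num K n"
proof (induction n)
  case 0
  then show ?case using mk_N[OF N.small_empty] by simp
next
  case (Suc n)
  have "small N (insert (num N n) (elts N (num N n)))"
    by (intro N.small_insert N.num_Dom small_elts N.isset_num)
  then show ?case using mk_N Suc elts_N[OF num_HS] by simp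
qed

lemma act_swap_num_N: "act_swap S (num N n) = num N n"
  using act_swap_num num_N by simp

sublocale N: zfa_omega N
proof unfold_locales
  show "small N (range (num N))"
    unfolding num_N
    using num_HS act_swap_num by (intro small_NI[where m = 0] small_range_num_K) auto
qed

lemma act_swap_mk_N: "small N X \<Longrightarrow> act_swap S (mk N X) = mk N (act_swap S ` X)"
proof -
  assume X: "small N X"
  then obtain x where x: "isset N x" "elts N x = X" unfolding small_def by blast
  then have "x \<in> HS" "isset K x" "elts K x = X" unfolding isset_N using elts_N by auto
  then have "isset N (act_swap S x)" "elts N (act_swap S x) = act_swap S ` X"
    unfolding isset_N using act_swap_HS isset_act_swap elts_N elts_act_swap HS_Dom by auto
  then have "mk N (act_swap S ` X) = act_swap S x" by (rule N.mk_eqI)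
  then show ?thesis using N.mk_eqI[OF x] by simp
qed

lemma act_swap_pr:
  assumes "a \<in> HS" "b \<in> HS"
  shows "act_swap S (pr N a b) = pr N (act_swap S a) (act_swap S b)"
  using N.small_pr[of a b] small_N_doubleton[of a a] small_N_doubleton[of a b] assms
  by (simp add: pr_def act_swap_mk_N N_simps)

lemma N_elts_HS: "x \<in> elts N X \<Longrightarrow> x \<in> HS"
  using elts_Dom[of x N X] N_simps by simp

lemma N_isset_HS: "isset N X \<Longrightarrow> X \<in> HS"
  unfolding isset_N by blast

lemma N_elts_supp:
  assumes "isset N X" "supp m X" "away m S" "x \<in> elts N X"
  shows "act_swap S x \<in> elts N X"
  using supp_elts[OF N_isset_HS[OF assms(1)] assms(2,3)] assms(4)
    elts_N[OF N_isset_HS[OF assms(1)]] by simp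

text \<open>The gate for subsets chosen outside: \<open>Y\<close> may be any HOL set, as long as the
  swaps away from some \<open>m\<close> do not lead out of it.\<close>

lemma N_subset_small:
  assumes "isset N X" "Y \<subseteq> elts N X"
    "\<And>S y. away m S \<Longrightarrow> y \<in> Y \<Longrightarrow> act_swap S y \<in> Y"
  shows "small N Y"
proof (rule small_NI[where m = m])
  have "small K (elts N X)" using small_N_K[OF small_elts[OF assms(1)]] .
  then show "small K Y" using assms(2) by (rule small_subset)
qed (use assms N_elts_HS in auto)

lemma rel_supp:
  assumes "isset N r" "supp m r" "away m S" "(a, b) \<in> rel N r"
  shows "(act_swap S a, act_swap S b) \<in> rel N r"
  using assms(4) N_elts_supp[OF assms(1-3)] act_swap_pr act_swap_HS
  unfolding N.rel_iff N_simps by force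

lemma app_supp:
  assumes f: "is_fun N f X Y" and "supp m f" "away m S" "x \<in> elts N X"
  shows "app N f (act_swap S x) = act_swap S (app N f x)"
  using N.app_eqI[OF f] rel_supp[OF N.fun_isset[OF f]] N.app_rel[OF f] assms by blast

text \<open>Converse to \<open>app_supp\<close>: an equivariant HOL function has an invariant graph,
  because the support of \<open>X\<close> keeps the domain closed under the swaps in
  question.\<close>

lemma N_fun_exists:
  assumes "isset N X" "isset N Y" "\<And>x. x \<in> elts N X \<Longrightarrow> f x \<in> elts N Y" "supp m X"
    and equiv: "\<And>S x. away m S \<Longrightarrow> x \<in> elts N X \<Longrightarrow> f (act_swap S x) = act_swap S (f x)"
  obtains \<phi> where "is_fun N \<phi> X Y" "\<And>x. x \<in> elts N X \<Longrightarrow> app N \<phi> x = f x"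
proof -
  have HS: "x \<in> HS" "f x \<in> HS" if "x \<in> elts N X" for x
    using that assms(3) N_elts_HS by blast+
  then have prHS: "pr N x (f x) \<in> HS" if "x \<in> elts N X" for x
    using that N.pr_Dom[of x "f x"] by (simp add: N_simps)
  have "small N ((\<lambda>x. pr N x (f x)) ` elts N X)"
  proof (rule small_NI[where m = m])
    show "small K ((\<lambda>x. pr N x (f x)) ` elts N X)"
      using small_N_K[OF small_elts[OF assms(1)]] prHS HS_Dom by (intro small_image) auto
    show "(\<lambda>x. pr N x (f x)) ` elts N X \<subseteq> HS" using prHS by blast
    fix S p assume S: "away m S" and "p \<in> (\<lambda>x. pr N x (f x)) ` elts N X"
    then obtain x where x: "x \<in> elts N X" "p = pr N x (f x)" by blast
    then have "act_swap S p = pr N (act_swap S x) (f (act_swap S x))"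
      using act_swap_pr[OF HS] equiv[OF S] by simp
    then show "act_swap S p \<in> (\<lambda>x. pr N x (f x)) ` elts N X"
      using N_elts_supp[OF assms(1,4) S x(1)] by blast
  qed
  then show ?thesis using N.fun_exists[OF assms(1,2), of f] assms(3) that by blast
qed

lemma finite_small_N:
  assumes "finite X" "X \<subseteq> HS"
  shows "small N X"
  using assms by (induction rule: finite_induct) (auto simp: N.small_empty N.small_insert N_simps)

text \<open>A bijection with a numeral is taken from outside. Its arguments are numerals, fixed by
  all swaps, and its finitely many values share a support, so equivariance reduces to a trivial
  equation.\<close>

lemma finite_in_N:
  assumes "isset N x" "finite (elts N x)"
  shows "finite_in N x"
proof -
  obtain h where h: "bij_betw h {0..<card (elts N x)} (elts N x)"
    using ex_bij_betw_nat_finite[OF assms(2)] by blast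
  let ?n = "card (elts N x)"
  let ?X = "num N ` {..<?n}"
  define f where "f y = h (inv_into UNIV (num N) y)" for y
  have f_num: "f (num N i) = h i" for i unfolding f_def by (simp add: N.inj_num)
  have bij: "bij_betw f ?X (elts N x)"
    using h N.inj_num unfolding bij_betw_def inj_on_def
    by (auto simp: f_num image_image lessThan_atLeast0)
  obtain m where m: "\<forall>y \<in> insert (num N ?n) (elts N x). supp m y"
    using HS_finite_supp[of "insert (num N ?n) (elts N x)"] assms N_elts_HS num_HS num_N by auto
  obtain \<phi> where \<phi>: "is_fun N \<phi> (num N ?n) x"
    "\<And>y. y \<in> elts N (num N ?n) \<Longrightarrow> app N \<phi> y = f y"
  proof (rule N_fun_exists[of "num N ?n" x f m])
    show fx: "f y \<in> elts N x" if "y \<in> elts N (num N ?n)" for y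
      using bij that unfolding N.elts_num bij_betw_def by blast
    show "f (act_swap S y) = act_swap S (f y)" if "away m S" "y \<in> elts N (num N ?n)" for S y
    proof -
      have "act_swap S (f y) = f y" using fx[OF that(2)] m that(1) unfolding supp_def by blast
      moreover have "act_swap S y = y" using that(2) act_swap_num_N unfolding N.elts_num by auto
      ultimately show ?thesis by simp
    qed
  qed (use assms m N.isset_num in auto)
  have "bij_betw (app N \<phi>) ?X (elts N x)"
    using bij \<phi>(2) bij_betw_cong[of ?X "app N \<phi>" f "elts N x"] unfolding N.elts_num by blast
  then show ?thesis
    unfolding finite_in_def is_bij_def N.is_nat_iff using assms(1) \<phi>(1) N.elts_num
    by (intro conjI exI[of _ "num N ?n"] exI[of _ \<phi>]) auto
qed


subsection \<open>Linearly orderable sets\<close>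

text \<open>An involution preserving a linear order is the identity.\<close>

lemma linearly_orderable_supp:
  assumes "linearly_orderable N X"
  obtains m where "\<And>x. x \<in> elts N X \<Longrightarrow> supp m x"
proof -
  obtain R where X: "isset N X" and R: "is_rel N R" "linear_order_on (elts N X) (rel N R)"
    using assms unfolding linearly_orderable_def by blast
  have Rs: "isset N R" using R unfolding is_rel_def by blast
  obtain m where m: "supp m X" "supp m R"
    using HS_finite_supp[of "{X, R}"] N_isset_HS X Rs by auto
  have "act_swap S x = x" if S: "away m S" and x: "x \<in> elts N X" for S x
  proof (rule ccontr)
    assume neq: "act_swap S x \<noteq> x"
    have Sx: "act_swap S x \<in> elts N X" using N_elts_supp[OF X m(1) S x] .
    have inv: "act_swap S (act_swap S x) = x"
      using act_swap_involution HS_Dom N_elts_HS x by blast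
    have "(x, act_swap S x) \<in> rel N R \<or> (act_swap S x, x) \<in> rel N R"
      using R(2) x Sx neq unfolding linear_order_on_def total_on_def by metis
    then have "(x, act_swap S x) \<in> rel N R \<and> (act_swap S x, x) \<in> rel N R"
      using rel_supp[OF Rs m(2) S] inv by metis
    then show False
      using R(2) neq unfolding linear_order_on_def partial_order_on_def antisym_def by blast
  qed
  then show ?thesis using that unfolding supp_def by blast
qed

text \<open>Arguments are fixed beyond \<open>n\<close> by the linear order, values beyond
  \<open>k\<close> by finiteness; beyond the maximum, equivariance of an arbitrary \<open>f\<close>
  says nothing more than \<open>f x = f x\<close>.\<close>

lemma N_fun_exists_linear:
  assumes X: "linearly_orderable N X" and Y: "isset N Y"
    and f: "\<And>x. x \<in> elts N X \<Longrightarrow> f x \<in> elts N Y" and fin: "finite (elts N Y)"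
  obtains \<phi> where "is_fun N \<phi> X Y" "\<And>x. x \<in> elts N X \<Longrightarrow> app N \<phi> x = f x"
proof -
  have Xs: "isset N X" using X unfolding linearly_orderable_def by blast
  obtain n where n: "\<And>x. x \<in> elts N X \<Longrightarrow> supp n x" using linearly_orderable_supp[OF X] by blast
  obtain k where k: "\<forall>y \<in> insert X (elts N Y). supp k y"
    using HS_finite_supp[of "insert X (elts N Y)"] fin N_elts_HS N_isset_HS[OF Xs] by auto
  show ?thesis
  proof (rule N_fun_exists[where X = X and Y = Y and f = f and m = "max n k"])
    show "supp (max n k) X" using k supp_mono by auto
    fix S x assume S: "away (max n k) S" and x: "x \<in> elts N X"
    have "supp (max n k) x" "supp (max n k) (f x)"
      using n[OF x] k f[OF x] supp_mono[of n _ "max n k"] supp_mono[of k _ "max n k"] by auto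
    then show "f (act_swap S x) = act_swap S (f x)" using S unfolding supp_def by simp
  qed (use Xs Y f that in auto)
qed


subsection \<open>Cofinal subsets in the model\<close>

text \<open>
  Comparing orbits under the pointwise stabilizer of a support gives a preorder whose equivalence
  classes are the orbits, because a comparable pair in one orbit would be swapped by an involution.
\<close>

definition orbit_le :: "nat \<Rightarrow> 'v \<Rightarrow> 'v \<Rightarrow> 'v \<Rightarrow> bool" where
  "orbit_le m R x y \<longleftrightarrow> (\<exists>S. away m S \<and> (act_swap S x, y) \<in> rel N R)"

context
  fixes P R m
  assumes poset: "is_poset N P R" and mP: "supp m P" and mR: "supp m R"
begin

lemma poset_sets: "isset N P" "isset N R"
  using poset unfolding is_poset_def is_rel_def by auto

lemma poset_refl: "x \<in> elts N P \<Longrightarrow> (x, x) \<in> rel N R"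
  using poset unfolding is_poset_def partial_order_on_def preorder_on_def refl_on_def by blast

lemma poset_trans: "(x, y) \<in> rel N R \<Longrightarrow> (y, z) \<in> rel N R \<Longrightarrow> (x, z) \<in> rel N R"
  using poset unfolding is_poset_def partial_order_on_def preorder_on_def trans_def by blast

lemma poset_antisym: "(x, y) \<in> rel N R \<Longrightarrow> (y, x) \<in> rel N R \<Longrightarrow> x = y"
  using poset unfolding is_poset_def partial_order_on_def antisym_def by blast

lemma poset_swap: "away m S \<Longrightarrow> (x, y) \<in> rel N R \<Longrightarrow> (act_swap S x, act_swap S y) \<in> rel N R"
  using rel_supp[OF poset_sets(2) mR] .

lemma carrier_swap: "away m S \<Longrightarrow> x \<in> elts N P \<Longrightarrow> act_swap S x \<in> elts N P"
  using N_elts_supp[OF poset_sets(1) mP] .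

lemma carrier_involution: "x \<in> elts N P \<Longrightarrow> act_swap S (act_swap S x) = x"
  using act_swap_involution HS_Dom N_elts_HS by blast

lemma orbit_le_rel: "(x, y) \<in> rel N R \<Longrightarrow> x \<in> elts N P \<Longrightarrow> orbit_le m R x y"
  unfolding orbit_le_def using act_swap_empty[of x] HS_Dom N_elts_HS away_empty by metis

lemma orbit_le_refl: "x \<in> elts N P \<Longrightarrow> orbit_le m R x x"
  using orbit_le_rel poset_refl by blast

lemma orbit_le_trans:
  assumes "x \<in> elts N P" "orbit_le m R x y" "orbit_le m R y z"
  shows "orbit_le m R x z"
proof -
  obtain S S' where S: "away m S" "(act_swap S x, y) \<in> rel N R" "away m S'"
    "(act_swap S' y, z) \<in> rel N R"
    using assms unfolding orbit_le_def by blast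
  then have "(act_swap S' (act_swap S x), z) \<in> rel N R" using poset_swap poset_trans by blast
  moreover have "act_swap S' (act_swap S x) = act_swap (sdiff S' S) x"
    using act_swap_swap HS_Dom N_elts_HS assms(1) by blast
  ultimately show ?thesis unfolding orbit_le_def using away_sdiff S by metis
qed

text \<open>Brings facts about orbits back to points: if some image of \<open>y\<close> lies below
  \<open>x\<close>, it lies below \<open>y\<close>; applying the same involution reverses this
  relation, so the image is \<open>y\<close> itself. Well-founded families of orbits thus become
  well-founded sets, and a point strictly above another lies in a strictly higher orbit.\<close>

lemma rel_orbit_le_eq:
  assumes "(x, y) \<in> rel N R" "orbit_le m R y x" "x \<in> elts N P" "y \<in> elts N P"
  shows "x = y"
proof -
  obtain S where S: "away m S" "(act_swap S y, x) \<in> rel N R"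
    using assms(2) unfolding orbit_le_def by blast
  then have yy: "(act_swap S y, y) \<in> rel N R" using assms(1) poset_trans by blast
  then have "(y, act_swap S y) \<in> rel N R"
    using poset_swap[OF S(1) yy] carrier_involution[OF assms(4)] by simp
  then have "act_swap S y = y" using yy poset_antisym by blast
  then show ?thesis using S assms(1) poset_antisym by simp
qed

lemma orbit_le_swap:
  assumes "away m S" "x \<in> elts N P"
  shows "orbit_le m R x (act_swap S x)" "orbit_le m R (act_swap S x) x"
  unfolding orbit_le_def
  using assms poset_refl carrier_swap carrier_involution by metis+

text \<open>A point and its image under a swap away from \<open>m\<close> are mutually comparable,
  so closure under mutual comparability includes closure under these swaps.\<close>

lemma orbit_closed_small:
  assumes "W \<subseteq> elts N P"
    and "\<And>x y. x \<in> W \<Longrightarrow> y \<in> elts N P \<Longrightarrow> orbit_le m R x y \<Longrightarrow> orbit_le m R y x \<Longrightarrow> y \<in> W"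
  shows "small N W" and "away m S \<Longrightarrow> x \<in> W \<Longrightarrow> act_swap S x \<in> W"
proof -
  show inv: "act_swap S x \<in> W" if "away m S" "x \<in> W" for S x
    using that assms carrier_swap orbit_le_swap by blast
  show "small N W" by (rule N_subset_small[OF poset_sets(1) assms(1) inv])
qed

lemma orbit_cofinal:
  assumes "W \<subseteq> elts N P" and cof: "\<And>x. x \<in> elts N P \<Longrightarrow> \<exists>y \<in> W. orbit_le m R x y"
    and cl: "\<And>x y. x \<in> W \<Longrightarrow> y \<in> elts N P \<Longrightarrow> orbit_le m R x y \<Longrightarrow> orbit_le m R y x \<Longrightarrow> y \<in> W"
  shows "cofinal_in N P R (mk N W)"
proof -
  have sm: "small N W" by (rule orbit_closed_small(1)[OF assms(1) cl])
  have "\<exists>c \<in> W. (p, c) \<in> rel N R" if p: "p \<in> elts N P" for p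
  proof -
    obtain y S where y: "y \<in> W" "away m S" "(act_swap S p, y) \<in> rel N R"
      using cof[OF p] unfolding orbit_le_def by blast
    \<comment> \<open>The swap is moved from \<open>p\<close> to the upper point, which stays in
      \<open>W\<close>.\<close>
    then have "(p, act_swap S y) \<in> rel N R"
      using poset_swap[OF y(2,3)] carrier_involution[OF p] by simp
    moreover have "act_swap S y \<in> W" by (rule orbit_closed_small(2)[OF assms(1) cl y(2,1)])
    ultimately show ?thesis by blast
  qed
  then show ?thesis
    unfolding cofinal_in_def N.elts_mk[OF sm] using N.isset_mk[OF sm] assms(1) by blast
qed

lemma poset_wf_cofinal: "\<exists>W. cofinal_in N P R W \<and> well_founded_in N R W"
proof -
  obtain W where W: "W \<subseteq> elts N P" "\<And>x. x \<in> elts N P \<Longrightarrow> \<exists>y \<in> W. orbit_le m R x y"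
    and cl: "\<And>x y. x \<in> W \<Longrightarrow> y \<in> elts N P \<Longrightarrow> orbit_le m R x y \<Longrightarrow> orbit_le m R y x \<Longrightarrow> y \<in> W"
    and wf: "\<And>X. X \<subseteq> W \<Longrightarrow> X \<noteq> {} \<Longrightarrow> \<exists>u \<in> X. \<forall>x \<in> X. orbit_le m R x u \<longrightarrow> orbit_le m R u x"
    by (rule preorder_wf_cofinal[of "elts N P" "orbit_le m R"])
      (blast intro: orbit_le_refl orbit_le_trans)+
  have sm: "small N W" by (rule orbit_closed_small(1)[OF W(1) cl])
  have "well_founded_in N R (mk N W)"
    unfolding well_founded_in_def N.elts_mk[OF sm]
  proof (intro allI impI, elim conjE)
    fix X assume X: "elts N X \<subseteq> W" "elts N X \<noteq> {}"
    then obtain u where u: "u \<in> elts N X"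
      "\<forall>x \<in> elts N X. orbit_le m R x u \<longrightarrow> orbit_le m R u x"
      using wf by blast
    have "x = u" if "x \<in> elts N X" "(x, u) \<in> rel N R" for x
      using that u X W(1) rel_orbit_le_eq[of x u] orbit_le_rel[of x u] by blast
    with u show "\<exists>u \<in> elts N X. \<forall>x \<in> elts N X. (x, u) \<in> rel N R \<longrightarrow> x = u" by blast
  qed
  moreover have "cofinal_in N P R (mk N W)" by (rule orbit_cofinal[OF W cl])
  ultimately show ?thesis by blast
qed

lemma poset_disjoint_cofinal:
  assumes no_max: "\<not> (\<exists>u \<in> elts N P. \<forall>p \<in> elts N P. (u, p) \<in> rel N R \<longrightarrow> p = u)"
  shows "\<exists>C D. cofinal_in N P R C \<and> cofinal_in N P R D \<and> elts N C \<inter> elts N D = {}"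
proof -
  have up: "\<exists>y \<in> elts N P. orbit_le m R x y \<and> \<not> orbit_le m R y x" if x: "x \<in> elts N P" for x
  proof -
    obtain y where "y \<in> elts N P" "(x, y) \<in> rel N R" "y \<noteq> x" using no_max x by blast
    then show ?thesis using rel_orbit_le_eq[of x y] orbit_le_rel[of x y] x by blast
  qed
  obtain C where C: "\<And>b. C b \<subseteq> elts N P" "C True \<inter> C False = {}"
    "\<And>b x. x \<in> elts N P \<Longrightarrow> \<exists>y \<in> C b. orbit_le m R x y"
    "\<And>b x y. x \<in> C b \<Longrightarrow> y \<in> elts N P \<Longrightarrow> orbit_le m R x y \<Longrightarrow> orbit_le m R y x \<Longrightarrow> y \<in> C b"
    by (rule preorder_disjoint_cofinal[of "elts N P" "orbit_le m R"])
      ((rule up, assumption) | (blast intro: orbit_le_refl orbit_le_trans))+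
  have "cofinal_in N P R (mk N (C b))" for b by (rule orbit_cofinal[OF C(1,3,4)])
  moreover have "small N (C b)" for b by (rule orbit_closed_small(1)[OF C(1,4)])
  then have "elts N (mk N (C True)) \<inter> elts N (mk N (C False)) = {}"
    using C(2) N.elts_mk by simp
  ultimately show ?thesis by blast
qed

end

lemma poset_supp:
  assumes "is_poset N P R"
  obtains m where "supp m P" "supp m R"
  using HS_finite_supp[of "{P, R}"] assms N_isset_HS
  unfolding is_poset_def is_rel_def by auto

lemma CWF_N: "CWF N"
  unfolding CWF_def using poset_supp poset_wf_cofinal by metis

lemma CS_N: "CS N"
  unfolding CS_def using poset_supp poset_disjoint_cofinal by metis


subsection \<open>Failure of countable choice for pairs\<close>

lemma not_AC_omega_fin_N: "\<not> AC_omega_fin N"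
proof
  assume ac: "AC_omega_fin N"
  have ptH: "pt n b \<in> HS" for n b using Atoms_HS Atoms_eq by blast
  have swap_pt_act: "act_swap S (pt n b) = pt n (b \<noteq> (n \<in> S))" for S n b
    using act_swap_atom[of "pt n b"] swap_pt Atoms_eq by auto
  let ?P = "\<lambda>n. {pt n False, pt n True}"
  define A where "A n = mk N (?P n)" for n
  have smP: "small N (?P n)" for n using small_N_doubleton ptH by blast
  have As: "isset N (A n)" "elts N (A n) = ?P n" for n
    unfolding A_def using N.isset_mk N.elts_mk smP by auto
  \<comment> \<open>Each pair is invariant as a set under the whole group, so the family and its
    enumeration have empty support; only the choice of a member breaks the symmetry.\<close>
  have AT: "act_swap S (A n) = A n" for S n
  proof -
    have "act_swap S ` ?P n = ?P n" by (cases "n \<in> S") (auto simp: swap_pt_act)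
    then show ?thesis unfolding A_def using act_swap_mk_N[OF smP] by simp
  qed
  have A_inj: "A m = A n \<longleftrightarrow> m = n" for m n
    using As(2)[of m] As(2)[of n] pt_inj by (metis insert_iff singletonD)
  have "small N (range A)"
  proof (rule small_NI[where m = 0])
    have "A n \<in> Dom K" for n using As(1)[of n] HS_Dom unfolding isset_N by blast
    then show "small K (range A)" by (intro small_countable) auto
  qed (use As(1) isset_N AT in auto)
  then obtain Z where Z: "isset N Z" "elts N Z = range A" unfolding small_def by blast
  define w where "w = mk N (range (num N))"
  have w: "isset N w" "elts N w = range (num N)"
    unfolding w_def using N.isset_mk N.elts_mk N.small_range_num by auto
  have "w \<in> HS" using w N_isset_HS by blast
  then obtain m where m: "supp m w" using HS_supp by blast
  define f where "f y = A (inv_into UNIV (num N) y)" for y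
  have f_num: "f (num N i) = A i" for i unfolding f_def by (simp add: N.inj_num)
  obtain \<phi> where \<phi>: "is_fun N \<phi> w Z" "\<And>y. y \<in> elts N w \<Longrightarrow> app N \<phi> y = f y"
  proof (rule N_fun_exists[of w Z f m])
    show "f (act_swap S x) = act_swap S (f x)" if "x \<in> elts N w" for S x
      using that unfolding w(2) by (auto simp: act_swap_num_N f_num AT)
  qed (use w Z m f_num in auto)
  have "bij_betw (app N \<phi>) (elts N w) (elts N Z)"
    unfolding bij_betw_def inj_on_def w(2) Z(2)
    using \<phi>(2) A_inj by (auto simp: w(2) f_num image_image)
  then have "countably_infinite_in N Z"
    unfolding countably_infinite_in_def is_bij_def N.is_omega_iff using \<phi>(1) Z(1) w_def by blast
  moreover have "finite_in N a \<and> elts N a \<noteq> {}" if "a \<in> elts N Z" for a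
    using that Z(2) As finite_in_N by auto
  ultimately have "has_choice_function N Z" using ac unfolding AC_omega_fin_def by blast
  then obtain g U where g: "is_fun N g Z U" "\<forall>a \<in> elts N Z. app N g a \<in> elts N a"
    unfolding has_choice_function_def by blast
  obtain n where n: "supp n g" using N.fun_isset[OF g(1)] N_isset_HS HS_supp by blast
  have "app N g (A n) \<in> ?P n" using g(2) Z(2) As(2) by blast
  then obtain b where b: "app N g (A n) = pt n b" by blast
  \<comment> \<open>A support \<open>n\<close> covers the pairs with index below \<open>n\<close>.
    The pair with index \<open>n\<close> is thus the first one beyond it, and exchanging its members
    fixes \<open>g\<close> but not the chosen atom.\<close>
  have "away n {n}" unfolding away_def by simp
  then have "app N g (act_swap {n} (A n)) = act_swap {n} (app N g (A n))"
    using app_supp[OF g(1) n] Z(2) by blast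
  then show False using b by (simp add: AT swap_pt_act pt_inj)
qed


subsection \<open>Graphs and vector spaces in the model\<close>

text \<open>Homomorphisms on finite vertex sets are read off inside the model and combined outside
  by compactness; the result returns to the model because the vertices of \<open>VG\<close> have a
  common support and \<open>VH\<close> is finite.\<close>

lemma hom_compactness_N:
  assumes G: "is_graph N VG EG" and lin: "linearly_orderable N VG"
    and H: "is_graph N VH EH" and fin: "finite_in N VH"
    and sub: "\<And>V' E'. is_subgraph N V' E' VG EG \<Longrightarrow> finite_in N V' \<Longrightarrow> has_hom N V' E' VH EH"
  shows "has_hom N VG EG VH EH"
proof -
  have finH: "finite (elts N VH)" by (rule N.finite_in_imp_finite[OF fin])
  have VHs: "isset N VH" and EGs: "isset N EG" using H G unfolding is_graph_def by auto
  obtain m where m: "\<And>x. x \<in> elts N VG \<Longrightarrow> supp m x"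
    using linearly_orderable_supp[OF lin] by blast
  have fin_hom: "\<exists>h. h ` S \<subseteq> elts N VH \<and> (\<forall>x \<in> S. \<forall>y \<in> S. adj N EG x y \<longrightarrow> adj N EH (h x) (h y))"
    if S: "finite S" "S \<subseteq> elts N VG" for S
  proof -
    have SH: "S \<subseteq> HS" using S N_elts_HS by blast
    have smS: "small N S" by (rule finite_small_N[OF S(1) SH])
    \<comment> \<open>The edges of the subgraph induced on \<open>S\<close>. They form a set of the
      model since all vertices, and hence all these edges, are fixed by the swaps away from
      \<open>m\<close>.\<close>
    let ?E = "{e \<in> elts N EG. \<exists>x \<in> S. \<exists>y \<in> S. e = mk N {x, y}}"
    have smE: "small N ?E"
    proof (rule N_subset_small[OF EGs, where m = m])
      fix T e assume T: "away m T" and e: "e \<in> ?E"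
      then obtain x y where xy: "x \<in> S" "y \<in> S" "e = mk N {x, y}" by blast
      then have "act_swap T x = x" "act_swap T y = y"
        using m S T unfolding supp_def by blast+
      moreover have "x \<in> HS" "y \<in> HS" using xy SH by auto
      ultimately have "act_swap T e = e"
        using act_swap_mk_N[OF small_N_doubleton, of x y T] xy(3) by simp
      then show "act_swap T e \<in> ?E" using e by simp
    qed blast
    have elts: "elts N (mk N S) = S" "elts N (mk N ?E) = ?E" "isset N (mk N S)" "isset N (mk N ?E)"
      using N.elts_mk N.isset_mk smS smE by auto
    have edge: "\<exists>x \<in> S. \<exists>y \<in> S. x \<noteq> y \<and> is_upair N x y e" if e: "e \<in> ?E" for e
    proof -
      obtain x y where xy: "x \<in> S" "y \<in> S" "e = mk N {x, y}" using e by blast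
      then have up: "is_upair N x y e" unfolding N.is_upair_iff N_simps using SH by blast
      obtain a b where ab: "a \<noteq> b" "is_upair N a b e" using e G unfolding is_graph_def by blast
      have "{x, y} = {a, b}" using up ab unfolding is_upair_def by simp
      then have "x \<noteq> y" using ab(1) by auto
      with up xy show ?thesis by blast
    qed
    have "is_subgraph N (mk N S) (mk N ?E) VG EG"
      unfolding is_subgraph_def is_graph_def elts(1,2) using elts(3,4) edge S(2) by blast
    moreover have "finite_in N (mk N S)" by (rule finite_in_N) (use elts S in auto)
    ultimately obtain h where h: "is_fun N h (mk N S) VH"
      "\<And>x y. adj N (mk N ?E) x y \<Longrightarrow> adj N EH (app N h x) (app N h y)"
      using sub unfolding has_hom_def by blast
    have "adj N EH (app N h x) (app N h y)" if "x \<in> S" "y \<in> S" "adj N EG x y" for x y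
      by (rule h(2)) (use that in \<open>auto simp: N.adj_iff elts(2)\<close>)
    moreover have "app N h ` S \<subseteq> elts N VH" using N.app_in[OF h(1)] elts(1) by auto
    ultimately show ?thesis by blast
  qed
  obtain h where h: "h ` elts N VG \<subseteq> elts N VH"
    "\<And>x y. x \<in> elts N VG \<Longrightarrow> y \<in> elts N VG \<Longrightarrow> adj N EG x y \<Longrightarrow> adj N EH (h x) (h y)"
    using hom_compactness[OF finH fin_hom] by blast
  obtain \<phi> where \<phi>: "is_fun N \<phi> VG VH" "\<And>x. x \<in> elts N VG \<Longrightarrow> app N \<phi> x = h x"
    by (rule N_fun_exists_linear[OF lin VHs _ finH, of h]) (use h(1) in blast)+
  have "adj N EH (app N \<phi> x) (app N \<phi> y)" if "adj N EG x y" for x y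
    using h(2) \<phi>(2) N.adj_in[OF G that] that by simp
  with \<phi>(1) show ?thesis unfolding has_hom_def by blast
qed

text \<open>The functional is normalized to take the value one at \<open>v\<close>, which differs
  from zero in a field.\<close>

lemma linear_functional_N:
  assumes VS: "is_vector_space N F ad mu z u V vad vz sc" and fin: "finite_in N F"
    and v: "v \<in> elts N V" "v \<noteq> vz" and lin: "linearly_orderable N V"
  obtains f where "is_linear_functional N F ad mu V vad sc f" "app N f v \<noteq> z"
proof -
  let ?R = "ring_of N F ad mu z u" and ?M = "module_of N V vad vz sc"
  have ops: "is_binop N vad V V V" "is_binop N sc F V V"
    and R: "field ?R" and M: "module ?R ?M" and Fs: "isset N F"
    using VS unfolding is_vector_space_def is_field_def is_binop_def by auto
  interpret module ?R ?M by (rule M)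
  interpret R: field ?R by (rule R)
  have simps: "carrier ?R = elts N F" "carrier ?M = elts N V" "monoid.mult ?R = app2 N mu"
    "add ?R = app2 N ad" "add ?M = app2 N vad" "module.smult ?M = app2 N sc"
    "zero ?R = z" "one ?R = u" "zero ?M = vz"
    unfolding ring_of_def module_of_def by simp_all
  obtain f where f: "\<And>x. x \<in> carrier ?M \<Longrightarrow> f x \<in> carrier ?R"
    "\<And>x y. x \<in> carrier ?M \<Longrightarrow> y \<in> carrier ?M \<Longrightarrow> f (x \<oplus>\<^bsub>?M\<^esub> y) = f x \<oplus>\<^bsub>?R\<^esub> f y"
    "\<And>c x. c \<in> carrier ?R \<Longrightarrow> x \<in> carrier ?M \<Longrightarrow> f (c \<odot>\<^bsub>?M\<^esub> x) = c \<otimes>\<^bsub>?R\<^esub> f x"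
    "f v = \<one>\<^bsub>?R\<^esub>"
    using nonzero_functional[OF R, of v] v unfolding simps by metis
  note f = f[unfolded simps]
  obtain \<phi> where \<phi>: "is_fun N \<phi> V F" "\<And>x. x \<in> elts N V \<Longrightarrow> app N \<phi> x = f x"
    using N_fun_exists_linear[where f = f, OF lin Fs f(1) N.finite_in_imp_finite[OF fin]] by blast
  have "is_linear_functional N F ad mu V vad sc \<phi>"
    unfolding is_linear_functional_def
    using \<phi> f N.app2_in[OF ops(1)] N.app2_in[OF ops(2)] by auto
  moreover have "app N \<phi> v \<noteq> z"
    using R.one_not_zero \<phi>(2)[OF v(1)] f(4) unfolding simps by simp
  ultimately show ?thesis by (rule that)
qed

text \<open>The pointwise values of a colouring of the product on a finite subgraph of the first
  factor without a good colouring would themselves colour the second factor.\<close>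

lemma no_small_product_coloring:
  assumes G1: "is_graph N V1 E1" and G2: "is_graph N V2 E2"
    and prod: "is_product_graph N V1 E1 V2 E2 V E" and lin: "linearly_orderable N V1"
    and no: "\<nexists>f. good_coloring N V1 E1 (num N j) f" and inf: "chromatic_infinite N V2 E2"
  shows "\<not> good_coloring N V E (num N j) f"
proof
  let ?C = "elts N (num N j)"
  assume "good_coloring N V E (num N j) f"
  then have f: "is_fun N f V (num N j)" "\<And>p q. adj N E p q \<Longrightarrow> app N f p \<noteq> app N f q"
    unfolding good_coloring_def by auto
  have finC: "finite ?C" by (simp add: N.elts_num)
  have V2s: "isset N V2" using G2 unfolding is_graph_def by blast
  have V_pr: "pr N x y \<in> elts N V" if "x \<in> elts N V1" "y \<in> elts N V2" for x y
    using N.cart_elts prod that unfolding is_product_graph_def by blast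
  \<comment> \<open>Compactness in contrapositive form: if every finite part of the first factor had
    a colouring with these colours, so would the whole graph, and linear orderability would place
    that colouring in the model.\<close>
  have "\<exists>S. finite S \<and> S \<subseteq> elts N V1 \<and>
      \<not> (\<exists>h. h ` S \<subseteq> ?C \<and> (\<forall>x \<in> S. \<forall>y \<in> S. adj N E1 x y \<longrightarrow> h x \<noteq> h y))"
  proof (rule ccontr)
    assume "\<not> ?thesis"
    then have fin_col: "\<exists>h. h ` S \<subseteq> ?C \<and> (\<forall>x \<in> S. \<forall>y \<in> S. adj N E1 x y \<longrightarrow> h x \<noteq> h y)"
      if "finite S" "S \<subseteq> elts N V1" for S
      using that by meson
    obtain h where h: "h ` elts N V1 \<subseteq> ?C"
      "\<And>x y. x \<in> elts N V1 \<Longrightarrow> y \<in> elts N V1 \<Longrightarrow> adj N E1 x y \<Longrightarrow> h x \<noteq> h y"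
      by (rule hom_compactness[where Q = "(\<noteq>)", OF finC fin_col])
        (assumption, assumption, rule that, assumption, blast)
    obtain \<phi> where \<phi>: "is_fun N \<phi> V1 (num N j)" "\<And>x. x \<in> elts N V1 \<Longrightarrow> app N \<phi> x = h x"
      by (rule N_fun_exists_linear[OF lin N.isset_num _ finC, of h]) (use h(1) in blast)+
    have "app N \<phi> x \<noteq> app N \<phi> y" if "adj N E1 x y" for x y
      using h(2) \<phi>(2) N.adj_in[OF G1 that] that by simp
    with \<phi>(1) no show False unfolding good_coloring_def by blast
  qed
  then obtain S where S: "finite S" "S \<subseteq> elts N V1"
    and none: "\<not> (\<exists>h. h ` S \<subseteq> ?C \<and> (\<forall>x \<in> S. \<forall>y \<in> S. adj N E1 x y \<longrightarrow> h x \<noteq> h y))"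
    by (elim exE conjE)
  have noS: "\<exists>x \<in> S. \<exists>y \<in> S. adj N E1 x y \<and> h x = h y" if "h ` S \<subseteq> ?C" for h
    using none that by meson
  \<comment> \<open>The colour patterns on \<open>S\<close> form a finite set, and numbering them by
    \<open>e\<close> turns them into colours for the second factor. The pattern \<open>r y\<close>
    of a vertex \<open>y\<close> is cut off outside \<open>S\<close> to be an element of this
    extensional function space.\<close>
  let ?B = "S \<rightarrow>\<^sub>E ?C"
  have "finite ?B" using S(1) finC by (simp add: finite_PiE)
  then obtain e where e: "bij_betw e ?B {0..<card ?B}" using ex_bij_betw_finite_nat by blast
  define r where "r y = restrict (\<lambda>x. app N f (pr N x y)) S" for y
  have rB: "r y \<in> ?B" if "y \<in> elts N V2" for y
    unfolding r_def using N.app_in[OF f(1) V_pr] that S(2) by auto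
  define c where "c y = num N (e (r y))" for y
  obtain m where m: "\<forall>x \<in> insert f (insert V2 S). supp m x"
    using HS_finite_supp[of "insert f (insert V2 S)"] S N_elts_HS N_isset_HS[OF V2s]
      N_isset_HS[OF N.fun_isset[OF f(1)]] by auto
  \<comment> \<open>A swap that fixes \<open>f\<close> and every point of \<open>S\<close> changes
    the pattern of \<open>y\<close> only by acting on the colours, and these are numerals. So the
    pattern is invariant even if \<open>y\<close> moves, which lets the induced colouring into the
    model without an order on \<open>V2\<close>.\<close>
  have r_inv: "r (act_swap T y) = r y" if T: "away m T" and y: "y \<in> elts N V2" for T y
  proof -
    have "app N f (pr N x (act_swap T y)) = app N f (pr N x y)" if x: "x \<in> S" for x
    proof -
      have "act_swap T x = x" using m x T unfolding supp_def by blast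
      moreover have "x \<in> HS" "y \<in> HS" using x y S(2) N_elts_HS by auto
      ultimately have "pr N x (act_swap T y) = act_swap T (pr N x y)" using act_swap_pr by simp
      moreover have xy: "pr N x y \<in> elts N V" using V_pr x y S(2) by blast
      ultimately have "app N f (pr N x (act_swap T y)) = act_swap T (app N f (pr N x y))"
        using app_supp[OF f(1) _ T xy] m by simp
      moreover obtain i where "app N f (pr N x y) = num N i"
        using N.app_in[OF f(1) xy] unfolding N.elts_num by blast
      ultimately show ?thesis using act_swap_num_N by simp
    qed
    then show ?thesis unfolding r_def by (intro restrict_ext) blast
  qed
  obtain \<phi> where \<phi>: "is_fun N \<phi> V2 (num N (card ?B))" "\<And>y. y \<in> elts N V2 \<Longrightarrow> app N \<phi> y = c y"
  proof (rule N_fun_exists[where X = V2 and Y = "num N (card ?B)" and f = c and m = m])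
    fix y assume "y \<in> elts N V2"
    then have "e (r y) \<in> {0..<card ?B}" using bij_betwE[OF e] rB by blast
    then show "c y \<in> elts N (num N (card ?B))" unfolding c_def N.elts_num[of "card ?B"] by simp
  next
    fix T y assume "away m T" "y \<in> elts N V2"
    then show "c (act_swap T y) = act_swap T (c y)"
      using r_inv act_swap_num_N unfolding c_def by simp
  qed (use V2s N.isset_num m in auto)
  have "\<not> good_coloring N V2 E2 (num N (card ?B)) \<phi>"
    using inf N.is_nat_iff unfolding chromatic_infinite_def by blast
  then obtain y y' where y: "adj N E2 y y'" "app N \<phi> y = app N \<phi> y'"
    using \<phi>(1) unfolding good_coloring_def by blast
  have yV: "y \<in> elts N V2" "y' \<in> elts N V2" using N.adj_in[OF G2 y(1)] by auto
  have "e (r y) = e (r y')"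
    using y(2) \<phi>(2) yV N.inj_num unfolding c_def by (simp add: inj_eq)
  then have rr: "r y = r y'" using e rB yV unfolding bij_betw_def inj_on_def by blast
  have "r y ` S \<subseteq> ?C" using rB[OF yV(1)] by auto
  \<comment> \<open>The common pattern of the adjacent vertices \<open>y\<close> and
    \<open>y'\<close> is a map from \<open>S\<close> to the colours, so by the choice of
    \<open>S\<close> it repeats a colour on an edge between \<open>x\<close> and \<open>x'\<close>.
    Together the two edges give a monochromatic edge of the product.\<close>
  then obtain x x' where x: "x \<in> S" "x' \<in> S" "adj N E1 x x'" "r y x = r y x'"
    using noS by blast
  then have "app N f (pr N x y) = app N f (pr N x' y')"
    using rr unfolding r_def by (metis restrict_apply')
  moreover have "adj N E (pr N x y) (pr N x' y')"
    unfolding N.product_adj[OF prod] using x(3) y(1) by blast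
  ultimately show False using f(2) by blast
qed

text \<open>A colouring of the first factor is composed with the first projection, which commutes
  with all swaps.\<close>

lemma product_coloring:
  assumes G1: "is_graph N V1 E1" and G2: "is_graph N V2 E2"
    and prod: "is_product_graph N V1 E1 V2 E2 V E" and "good_coloring N V1 E1 k f"
  obtains g where "good_coloring N V E k g"
proof -
  have f: "is_fun N f V1 k" "\<And>x y. adj N E1 x y \<Longrightarrow> app N f x \<noteq> app N f y"
    using assms(4) unfolding good_coloring_def by auto
  have ks: "isset N k" using f(1) unfolding is_fun_def by blast
  have cart: "is_cart N V1 V2 V" using prod unfolding is_product_graph_def by blast
  then have Vs: "isset N V" unfolding is_cart_def by blast
  \<comment> \<open>Both components are restricted to \<open>HS\<close>, the domain of the model,
    because pairs are known to be injective only there.\<close>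
  define fst' where "fst' p = (THE x. \<exists>y. x \<in> HS \<and> y \<in> HS \<and> p = pr N x y)" for p
  have fst': "fst' (pr N x y) = x" if "x \<in> HS" "y \<in> HS" for x y
    unfolding fst'_def using N.pr_inj that unfolding N_simps by (intro the_equality) blast+
  obtain m where m: "supp m V" "supp m f"
    using HS_finite_supp[of "{V, f}"] N_isset_HS[OF Vs] N_isset_HS[OF N.fun_isset[OF f(1)]] by auto
  obtain \<phi> where \<phi>: "is_fun N \<phi> V k" "\<And>p. p \<in> elts N V \<Longrightarrow> app N \<phi> p = app N f (fst' p)"
  proof (rule N_fun_exists[where X = V and Y = k and f = "\<lambda>p. app N f (fst' p)" and m = m])
    fix p assume "p \<in> elts N V"
    then obtain x y where xy: "x \<in> elts N V1" "y \<in> elts N V2" "p = pr N x y"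
      using N.cart_elts[OF cart] by blast
    then have H: "x \<in> HS" "y \<in> HS" using N_elts_HS by auto
    show "app N f (fst' p) \<in> elts N k" using fst'[OF H] xy N.app_in[OF f(1)] by simp
    fix S assume S: "away m S"
    show "app N f (fst' (act_swap S p)) = act_swap S (app N f (fst' p))"
      using fst'[OF H] fst'[OF act_swap_HS[OF H(1)] act_swap_HS[OF H(2)]] act_swap_pr[OF H] xy
        app_supp[OF f(1) m(2) S xy(1)] by simp
  qed (use Vs ks m in auto)
  have "app N \<phi> p \<noteq> app N \<phi> q" if pq: "adj N E p q" for p q
  proof -
    obtain x0 x1 y0 y1 where *: "adj N E1 x0 y0" "adj N E2 x1 y1" "p = pr N x0 x1" "q = pr N y0 y1"
      using pq unfolding N.product_adj[OF prod] by blast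
    have "x0 \<in> elts N V1" "y0 \<in> elts N V1" "x1 \<in> elts N V2" "y1 \<in> elts N V2"
      using N.adj_in[OF G1 *(1)] N.adj_in[OF G2 *(2)] by auto
    moreover then have "p \<in> elts N V" "q \<in> elts N V" using N.cart_elts[OF cart] * by auto
    ultimately show ?thesis using \<phi>(2) fst' N_elts_HS f(2)[OF *(1)] *(3,4) by simp
  qed
  with \<phi>(1) that show ?thesis unfolding good_coloring_def by blast
qed

lemma chromatic_product_N:
  assumes "is_graph N V1 E1" "is_graph N V2 E2" "is_product_graph N V1 E1 V2 E2 V E"
    and "linearly_orderable N V1" "chromatic_eq N V1 E1 k" "chromatic_infinite N V2 E2"
  shows "chromatic_eq N V E k"
proof -
  have k: "is_nat N k" "\<exists>f. good_coloring N V1 E1 k f"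
    "\<And>m. m \<in> elts N k \<Longrightarrow> \<nexists>f. good_coloring N V1 E1 m f"
    using assms(5) unfolding chromatic_eq_def by auto
  have "\<exists>f. good_coloring N V E k f" using k(2) product_coloring[OF assms(1-3)] by blast
  moreover have "\<nexists>f. good_coloring N V E m f" if m: "m \<in> elts N k" for m
  proof -
    obtain i where "k = num N i" using k(1) N.is_nat_iff by blast
    then obtain j where j: "m = num N j" using m N.elts_num by auto
    show ?thesis
      using no_small_product_coloring[OF assms(1-4) _ assms(6), of j] k(3)[OF m] unfolding j by blast
  qed
  ultimately show ?thesis using k(1) unfolding chromatic_eq_def by blast
qed

end

text \<open>The list of atoms is cut into consecutive pairs with indices \<open>2 * n\<close> and
  \<open>2 * n + 1\<close>; quotient and parity recover the position of an atom.\<close>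

lemma (in zfa_univ) atom_pairs_with_atoms:
  "atom_pairs (with_atoms K) (\<lambda>n b. atom K (2 * n + of_bool b))"
proof (intro atom_pairs.intro zfa_univ_M atom_pairs_axioms.intro wf_mem_M)
  show "atom K (2 * m + of_bool b) = atom K (2 * n + of_bool c) \<longleftrightarrow> m = n \<and> b = c" for m n b c
    unfolding inj_eq[OF inj_atom] by (cases b; cases c; simp; presburger)
  have "atom K n \<in> {atom K (2 * n + of_bool b) |n b. True}" for n
    by (rule CollectI, rule exI[of _ "n div 2"], rule exI[of _ "odd n"]) simp
  then show "Atoms (with_atoms K) = {atom K (2 * n + of_bool b) |n b. True}"
    unfolding M_simps by blast
qed

theorem theorem4p8:
  fixes U :: "'v zfa_struct"
  assumes "zfac_universe U"
  shows "\<exists>N :: 'v zfa_struct. permutation_model N \<and> ZFA N \<and>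
    CS N \<and> CWF N \<and> \<not> AC_omega_fin N \<and>
    (\<forall>k three V1 E1 V2 E2 V E.
       is_nat N k \<and> is_numeral N 3 three \<and> elts N three \<subseteq> elts N k \<and>
       is_graph N V1 E1 \<and> is_graph N V2 E2 \<and> is_product_graph N V1 E1 V2 E2 V E \<and>
       linearly_orderable N V1 \<and> chromatic_eq N V1 E1 k \<and> chromatic_infinite N V2 E2 \<longrightarrow>
       chromatic_eq N V E k) \<and>
    (\<forall>VG EG VH EH.
       is_graph N VG EG \<and> \<not> finite_in N VG \<and> linearly_orderable N VG \<and>
       is_graph N VH EH \<and> finite_in N VH \<and>
       (\<forall>V' E'. is_subgraph N V' E' VG EG \<and> finite_in N V' \<longrightarrow> has_hom N V' E' VH EH) \<longrightarrow>
       has_hom N VG EG VH EH) \<and>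
    (\<forall>F ad mu z u V vad vz sc.
       is_field N F ad mu z u \<and> finite_in N F \<and>
       is_vector_space N F ad mu z u V vad vz sc \<and> (\<exists>x \<in> elts N V. x \<noteq> vz) \<and>
       linearly_orderable N V \<longrightarrow>
       (\<exists>f. is_linear_functional N F ad mu V vad sc f \<and> (\<exists>x \<in> elts N V. app N f x \<noteq> z)))"
proof -
  interpret U: zfa_univ U by (rule zfa_univI[OF assms])
  interpret atom_pairs "with_atoms U" "\<lambda>n b. atom U (2 * n + of_bool b)"
    by (rule U.atom_pairs_with_atoms)
  show ?thesis
  proof (intro exI[of _ N] conjI allI impI)
    fix k three V1 E1 V2 E2 V E
    assume "is_nat N k \<and> is_numeral N 3 three \<and> elts N three \<subseteq> elts N k \<and>
       is_graph N V1 E1 \<and> is_graph N V2 E2 \<and> is_product_graph N V1 E1 V2 E2 V E \<and>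
       linearly_orderable N V1 \<and> chromatic_eq N V1 E1 k \<and> chromatic_infinite N V2 E2"
    then show "chromatic_eq N V E k" using chromatic_product_N by blast
  next
    fix VG EG VH EH
    assume *: "is_graph N VG EG \<and> \<not> finite_in N VG \<and> linearly_orderable N VG \<and>
       is_graph N VH EH \<and> finite_in N VH \<and>
       (\<forall>V' E'. is_subgraph N V' E' VG EG \<and> finite_in N V' \<longrightarrow> has_hom N V' E' VH EH)"
    show "has_hom N VG EG VH EH" by (rule hom_compactness_N) (use * in simp_all)
  next
    fix F ad mu z u V vad vz sc
    assume *: "is_field N F ad mu z u \<and> finite_in N F \<and>
       is_vector_space N F ad mu z u V vad vz sc \<and> (\<exists>x \<in> elts N V. x \<noteq> vz) \<and>
       linearly_orderable N V"
    then obtain x where "x \<in> elts N V" "x \<noteq> vz" by blast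
    then show "\<exists>f. is_linear_functional N F ad mu V vad sc f \<and> (\<exists>x \<in> elts N V. app N f x \<noteq> z)"
      using * linear_functional_N by metis
  qed (rule permutation_model_N ZFA_N CS_N CWF_N not_AC_omega_fin_N)+
qed

end
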